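(* Let $G$ be an ample groupoid that is covered by countably many open bisections. For $x\in G^{(0)}$ let $b\colon G^x_x\to\mathbb{C}$ be a function with finite support $\{g_1,\dots,g_n\}$ (the $g_i$ distinct) such that $\sum_{g\in kX}b(g)=0$ for all $k\in G^x_x$ and $X\in\mathcal{X}(x)$, let $h\in G_x$, and let $V_1,\dots,V_n$ be open bisections containing $hg_1,\dots,hg_n$ respectively. There exists an admissible compact open neighbourhood $W\subseteq\bigcap_{i=1}^n s(V_i)$ of $x$, and for every such $W$ the function $$f^W:=\sum_{i=1}^n b(g_i)\,\mathbbm{1}_{U_i},\qquad U_i:=V_i\cap s^{-1}(W),$$ belongs to the algebraic singular ideal $J_{\mathbb{C}}$. Furthermore, $J_{\mathbb{C}}$ is equal to the linear span of the functions of the form $f^W$ (over all choices of $x,b,h,V_1,\dots,V_n$ and admissible compact open $W$).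
   Context: An étale groupoid $G$ is a locally compact topological groupoid (possibly non-Hausdorff) whose unit space $G^{(0)}$ is Hausdorff and whose range and source maps $r,s\colon G\to G^{(0)}$ are local homeomorphisms. $G_x=s^{-1}(x)$ and $G^x_x=\{g: r(g)=s(g)=x\}$. An open bisection is an open $U\subseteq G$ on which $r$ and $s$ restrict to homeomorphisms onto $r(U)$, $s(U)$. An ample groupoid is an étale groupoid with a basis of compact open bisections. Its complex Steinberg algebra is $\mathbb{C}G:=\mathrm{span}\{\mathbbm{1}_U: U\subseteq G\text{ a compact open bisection}\}$. Connes' algebra $\mathscr{C}_c(G)\supseteq\mathbb{C}G$ is the linear span of functions $f\colon G\to\mathbb{C}$ for which there is an open bisection $U$ with $f|_U\in C_c(U)$, $f|_{G\setminus U}=0$, with convolution product and involution $f^*(g)=\overline{f(g^{-1})}$. $C^*_r(G)$ is the completion of $\mathscr{C}_c(G)$ in the norm $\sup_x\|\lambda_x(f)\|$, where $\lambda_x(f)\xi=f*\xi$ on $\ell^2(G_x)$; its elements are viewed as functions on $G$ via $a(g)=\langle\lambda_{s(g)}(a)\delta_{s(g)},\delta_g\rangle$. The singular ideal is $J=\{a\in C^*_r(G): \{g: a(g)\neq0\}\text{ has empty interior}\}$ and the algebraic singular ideal is $J_{\mathbb{C}}:=J\cap\mathbb{C}G$. A unit $x\in G^{(0)}$ is Hausdorff if every $g\in G^x_x\setminus\{x\}$ has an open neighbourhood $U$ with $U\cap G^{(0)}=\emptyset$; $C\subseteq G^{(0)}$ is the set of Hausdorff units. For $x\in G^{(0)}$,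 $\mathcal{X}(x)$ is the set of subgroups $X\subseteq G^x_x$ for which there is a net $(x_\alpha)$ in $C$ whose set of limits in $G$ is precisely $X$ and such that every subnet of $(x_\alpha)$ has all of its limits contained in $X$. Given $x,b,h,V_1,\dots,V_n$ as in the claim, an open neighbourhood $W\subseteq\bigcap_i s(V_i)$ of $x$ is called admissible if, with $U_i:=V_i\cap s^{-1}(W)$, one has $W_I:=s\big(\bigcap_{i\in I}U_i\setminus\bigcup_{j\notin I}U_j\big)\cap C=\emptyset$ for every non-empty $I\subseteq\{1,\dots,n\}$ that is not of the form $\{hg_i: i\in I\}=kX\cap\{hg_1,\dots,hg_n\}$ for some $k\in G_x$ and $X\in\mathcal{X}(x)$. *)

theory Defs
  imports "HOL-Analysis.Analysis" "HOL-Algebra.Group" "HOL-Library.Function_Algebras"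
begin

section \<open>Complex-valued functions as a complex vector space\<close>

interpretation cfun: vector_space "\<lambda>(c::complex) f (x::'a). c * f x"
  by unfold_locales (simp_all add: fun_eq_iff algebra_simps)


section \<open>Nets\<close>

definition directed_set :: "'i set \<Rightarrow> ('i \<Rightarrow> 'i \<Rightarrow> bool) \<Rightarrow> bool" where
  "directed_set I lq \<longleftrightarrow> I \<noteq> {} \<and> (\<forall>i\<in>I. lq i i) \<and>
     (\<forall>i\<in>I. \<forall>j\<in>I. \<forall>k\<in>I. lq i j \<longrightarrow> lq j k \<longrightarrow> lq i k) \<and>
     (\<forall>i\<in>I. \<forall>j\<in>I. \<exists>k\<in>I. lq i k \<and> lq j k)"

definition tail_filter :: "'i set \<Rightarrow> ('i \<Rightarrow> 'i \<Rightarrow> bool) \<Rightarrow> 'i filter" where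
  "tail_filter I lq = (INF i\<in>I. principal {j\<in>I. lq i j})"

definition net_limits ::
    "'i set \<Rightarrow> ('i \<Rightarrow> 'i \<Rightarrow> bool) \<Rightarrow> ('i \<Rightarrow> 'g::topological_space) \<Rightarrow> 'g set" where
  "net_limits I lq z = {g. (z \<longlongrightarrow> g) (tail_filter I lq)}"

text \<open>Subnets in the sense of Kelley: the net \<open>z\<close> indexed by \<open>I\<close> has the subnets
  \<open>z \<circ> \<phi>\<close> indexed by \<open>J\<close>.\<close>

definition subnet_map ::
    "'j set \<Rightarrow> ('j \<Rightarrow> 'j \<Rightarrow> bool) \<Rightarrow> 'i set \<Rightarrow> ('i \<Rightarrow> 'i \<Rightarrow> bool) \<Rightarrow> ('j \<Rightarrow> 'i) \<Rightarrow> bool" where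
  "subnet_map J lq' I lq \<phi> \<longleftrightarrow> directed_set J lq' \<and> \<phi> ` J \<subseteq> I \<and>
     (\<forall>i\<in>I. \<exists>j\<in>J. \<forall>j'\<in>J. lq' j j' \<longrightarrow> lq i (\<phi> j'))"

lemma eventually_tail_filter:
  assumes "directed_set I lq"
  shows "eventually P (tail_filter I lq) \<longleftrightarrow> (\<exists>i\<in>I. \<forall>j\<in>I. lq i j \<longrightarrow> P j)"
proof -
  have "eventually P (tail_filter I lq) \<longleftrightarrow> (\<exists>i\<in>I. eventually P (principal {j\<in>I. lq i j}))"
    unfolding tail_filter_def
  proof (rule eventually_INF_base)
    show "I \<noteq> {}" using assms by (simp add: directed_set_def)
    fix a b assume "a \<in> I" "b \<in> I"
    then obtain k where k: "k \<in> I" "lq a k" "lq b k"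
      using assms unfolding directed_set_def by meson
    have "lq a j \<and> lq b j" if "j \<in> I" "lq k j" for j
      using assms k that \<open>a \<in> I\<close> \<open>b \<in> I\<close> unfolding directed_set_def by meson
    then show "\<exists>x\<in>I. principal {j \<in> I. lq x j} \<le>
        inf (principal {j \<in> I. lq a j}) (principal {j \<in> I. lq b j})"
      using k(1) by (intro bexI[of _ k]) auto
  qed
  then show ?thesis by (auto simp: eventually_principal)
qed


section \<open>Groupoids\<close>

text \<open>A groupoid is identified with its set of arrows, which is the whole type \<open>'g\<close>; the units
  are themselves arrows. The value of a product of two arrows that are not composable is
  irrelevant.\<close>

record 'g groupoid_struct =
  src :: "'g \<Rightarrow> 'g"
  rng :: "'g \<Rightarrow> 'g"
  ginv :: "'g \<Rightarrow> 'g"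
  gcomp :: "'g \<Rightarrow> 'g \<Rightarrow> 'g"  (infixl \<open>\<cdot>\<index>\<close> 70)

definition units :: "'g groupoid_struct \<Rightarrow> 'g set" where
  "units G = range (src G)"

locale groupoid =
  fixes G :: "'g groupoid_struct" (structure)
  assumes src_src: "src G (src G g) = src G g"
    and rng_src: "rng G (src G g) = src G g"
    and src_rng: "src G (rng G g) = rng G g"
    and rng_rng: "rng G (rng G g) = rng G g"
    and src_comp: "src G g = rng G h \<Longrightarrow> src G (g \<cdot> h) = src G h"
    and rng_comp: "src G g = rng G h \<Longrightarrow> rng G (g \<cdot> h) = rng G g"
    and comp_assoc: "src G g = rng G h \<Longrightarrow> src G h = rng G k \<Longrightarrow> (g \<cdot> h) \<cdot> k = g \<cdot> (h \<cdot> k)"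
    and comp_src: "g \<cdot> src G g = g"
    and rng_comp_left: "rng G g \<cdot> g = g"
    and src_inv: "src G (ginv G g) = rng G g"
    and rng_inv: "rng G (ginv G g) = src G g"
    and comp_inv: "g \<cdot> ginv G g = rng G g"
    and inv_comp: "ginv G g \<cdot> g = src G g"

locale topological_groupoid = groupoid G
  for G :: "'g::topological_space groupoid_struct" (structure) +
  assumes continuous_comp: "continuous_on {(g, h). src G g = rng G h} (\<lambda>(g, h). g \<cdot> h)"
    and continuous_inv: "continuous_on UNIV (ginv G)"

definition local_homeomorphism ::
    "('a::topological_space \<Rightarrow> 'b::topological_space) \<Rightarrow> 'b set \<Rightarrow> bool" where
  "local_homeomorphism f Y \<longleftrightarrow> range f \<subseteq> Y \<and>
     (\<forall>x. \<exists>U. open U \<and> x \<in> U \<and> openin (top_of_set Y) (f ` U) \<and>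
        homeomorphic_map (top_of_set U) (top_of_set (f ` U)) f)"

locale etale_groupoid = topological_groupoid G
  for G :: "'g::topological_space groupoid_struct" (structure) +
  assumes locally_compact_arrows: "locally_compact_space (euclidean :: 'g topology)"
    and Hausdorff_unit_space: "Hausdorff_space (top_of_set (units G))"
    and local_homeo_src: "local_homeomorphism (src G) (units G)"
    and local_homeo_rng: "local_homeomorphism (rng G) (units G)"

definition open_bisection :: "'g::topological_space groupoid_struct \<Rightarrow> 'g set \<Rightarrow> bool" where
  "open_bisection G U \<longleftrightarrow> open U \<and>
     homeomorphic_map (top_of_set U) (top_of_set (rng G ` U)) (rng G) \<and>
     homeomorphic_map (top_of_set U) (top_of_set (src G ` U)) (src G)"

locale ample_groupoid = etale_groupoid G
  for G :: "'g::topological_space groupoid_struct" (structure) +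
  assumes basis: "topological_basis {U. open_bisection G U \<and> compact U}"

definition source_fibre :: "'g groupoid_struct \<Rightarrow> 'g \<Rightarrow> 'g set" where
  "source_fibre G x = {g. src G g = x}"

definition isotropy :: "'g groupoid_struct \<Rightarrow> 'g \<Rightarrow> 'g set" where
  "isotropy G x = {g. rng G g = x \<and> src G g = x}"

definition isotropy_group :: "'g groupoid_struct \<Rightarrow> 'g \<Rightarrow> 'g monoid" where
  "isotropy_group G x = \<lparr>carrier = isotropy G x, mult = gcomp G, one = x\<rparr>"

definition left_coset :: "'g groupoid_struct \<Rightarrow> 'g \<Rightarrow> 'g set \<Rightarrow> 'g set" where
  "left_coset G k X = (\<lambda>g. k \<cdot>\<^bsub>G\<^esub> g) ` X"


section \<open>The Steinberg algebra and Connes' algebra\<close>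

definition Steinberg_algebra ::
    "'g::topological_space groupoid_struct \<Rightarrow> ('g \<Rightarrow> complex) set" where
  "Steinberg_algebra G = cfun.span {indicator U | U. open_bisection G U \<and> compact U}"

text \<open>The set \<open>U \<inter> closure {g \<in> U. f g \<noteq> 0}\<close> is the support of \<open>f\<close> restricted to \<open>U\<close>, that is,
  the closure is taken relative to \<open>U\<close>.\<close>

definition Connes_algebra ::
    "'g::topological_space groupoid_struct \<Rightarrow> ('g \<Rightarrow> complex) set" where
  "Connes_algebra G = cfun.span {f. \<exists>U. open_bisection G U \<and> continuous_on U f \<and>
     compact (U \<inter> closure {g\<in>U. f g \<noteq> 0}) \<and> (\<forall>g. g \<notin> U \<longrightarrow> f g = 0)}"


section \<open>The reduced groupoid C*-algebra\<close>

text \<open>Elements of \<open>\<ell>\<^sup>2(G\<^sub>x)\<close> are functions on \<open>G\<close> that vanish outside \<open>G\<^sub>x\<close>.\<close>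

definition ell2 :: "'g groupoid_struct \<Rightarrow> 'g \<Rightarrow> ('g \<Rightarrow> complex) set" where
  "ell2 G x = {\<xi>. (\<forall>g. g \<notin> source_fibre G x \<longrightarrow> \<xi> g = 0) \<and>
     (\<lambda>g. (cmod (\<xi> g))\<^sup>2) summable_on source_fibre G x}"

definition ell2_inner :: "'g groupoid_struct \<Rightarrow> 'g \<Rightarrow> ('g \<Rightarrow> complex) \<Rightarrow> ('g \<Rightarrow> complex) \<Rightarrow> complex"
  where "ell2_inner G x \<xi> \<eta> = (\<Sum>\<^sub>\<infinity>g\<in>source_fibre G x. \<xi> g * cnj (\<eta> g))"

definition ell2_norm :: "'g groupoid_struct \<Rightarrow> 'g \<Rightarrow> ('g \<Rightarrow> complex) \<Rightarrow> real" where
  "ell2_norm G x \<xi> = sqrt (\<Sum>\<^sub>\<infinity>g\<in>source_fibre G x. (cmod (\<xi> g))\<^sup>2)"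

definition conv :: "'g groupoid_struct \<Rightarrow> ('g \<Rightarrow> complex) \<Rightarrow> ('g \<Rightarrow> complex) \<Rightarrow> 'g \<Rightarrow> complex" where
  "conv G f \<xi> g = (\<Sum>\<^sub>\<infinity>h\<in>source_fibre G (src G g). f (g \<cdot>\<^bsub>G\<^esub> ginv G h) * \<xi> h)"

text \<open>An element of the product of the algebras of operators on \<open>\<ell>\<^sup>2(G\<^sub>x)\<close>, where \<open>x\<close> ranges over
  the units, is a family \<open>T\<close> with \<open>T x \<xi> \<in> \<ell>\<^sup>2(G\<^sub>x)\<close>; it is extended by \<open>0\<close> to arguments where it
  carries no information.\<close>

type_synonym 'g operator_family = "'g \<Rightarrow> ('g \<Rightarrow> complex) \<Rightarrow> 'g \<Rightarrow> complex"

definition bounded_operator_families :: "'g groupoid_struct \<Rightarrow> 'g operator_family set" where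
  "bounded_operator_families G = {T.
     (\<forall>x \<xi>. x \<notin> units G \<or> \<xi> \<notin> ell2 G x \<longrightarrow> T x \<xi> = 0) \<and>
     (\<forall>x\<in>units G. \<forall>\<xi>\<in>ell2 G x. T x \<xi> \<in> ell2 G x) \<and>
     (\<forall>x\<in>units G. \<forall>\<xi>\<in>ell2 G x. \<forall>\<eta>\<in>ell2 G x. T x (\<xi> + \<eta>) = T x \<xi> + T x \<eta>) \<and>
     (\<forall>x\<in>units G. \<forall>\<xi>\<in>ell2 G x. \<forall>c. T x (\<lambda>g. c * \<xi> g) = (\<lambda>g. c * T x \<xi> g)) \<and>
     (\<exists>M. \<forall>x\<in>units G. \<forall>\<xi>\<in>ell2 G x. ell2_norm G x (T x \<xi>) \<le> M * ell2_norm G x \<xi>)}"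

definition operator_family_norm :: "'g groupoid_struct \<Rightarrow> 'g operator_family \<Rightarrow> real" where
  "operator_family_norm G T =
     (SUP (x, \<xi>) \<in> {(x, \<xi>). x \<in> units G \<and> \<xi> \<in> ell2 G x \<and> ell2_norm G x \<xi> \<le> 1}.
        ell2_norm G x (T x \<xi>))"

definition regular_rep :: "'g groupoid_struct \<Rightarrow> ('g \<Rightarrow> complex) \<Rightarrow> 'g operator_family" where
  "regular_rep G f x \<xi> = (if x \<in> units G \<and> \<xi> \<in> ell2 G x then conv G f \<xi> else 0)"

text \<open>By definition \<open>operator_family_norm G (regular_rep G f)\<close> is the reduced norm of \<open>f\<close>, so
  \<open>regular_rep G\<close> embeds Connes' algebra isometrically into the complete space of bounded operator
  families. Its completion is the closure of its image.\<close>

definition reduced_Cstar ::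
    "'g::topological_space groupoid_struct \<Rightarrow> 'g operator_family set" where
  "reduced_Cstar G = {T \<in> bounded_operator_families G.
     \<forall>\<epsilon>>0. \<exists>f\<in>Connes_algebra G. operator_family_norm G (T - regular_rep G f) \<le> \<epsilon>}"

definition as_function :: "'g groupoid_struct \<Rightarrow> 'g operator_family \<Rightarrow> 'g \<Rightarrow> complex" where
  "as_function G T g =
     ell2_inner G (src G g) (T (src G g) (indicator {src G g})) (indicator {g})"

definition singular_ideal ::
    "'g::topological_space groupoid_struct \<Rightarrow> 'g operator_family set" where
  "singular_ideal G = {T \<in> reduced_Cstar G. interior {g. as_function G T g \<noteq> 0} = {}}"

text \<open>The intersection of the singular ideal with the Steinberg algebra, the latter being
  included in the reduced C*-algebra through \<open>regular_rep G\<close>.\<close>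

definition algebraic_singular_ideal ::
    "'g::topological_space groupoid_struct \<Rightarrow> ('g \<Rightarrow> complex) set" where
  "algebraic_singular_ideal G = {f \<in> Steinberg_algebra G. regular_rep G f \<in> singular_ideal G}"


section \<open>Hausdorff units and limit groups\<close>

definition Hausdorff_units :: "'g::topological_space groupoid_struct \<Rightarrow> 'g set" where
  "Hausdorff_units G = {x \<in> units G.
     \<forall>g \<in> isotropy G x - {x}. \<exists>U. open U \<and> g \<in> U \<and> U \<inter> units G = {}}"

text \<open>Index sets of nets and of their subnets are taken from two fixed types, since a formula
  cannot quantify over types. These types are large enough for the restriction to be harmless;
  see the lemmas \<open>limit_groupsI\<close> and \<open>limit_groupsE\<close> below, in which the index types are
  arbitrary.\<close>

definition limit_groups :: "'g::topological_space groupoid_struct \<Rightarrow> 'g \<Rightarrow> 'g set set" where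
  "limit_groups G x = {X. subgroup X (isotropy_group G x) \<and>
     (\<exists>(I :: ('g \<times> 'g set) set) lq z. directed_set I lq \<and> z ` I \<subseteq> Hausdorff_units G \<and>
        net_limits I lq z = X \<and>
        (\<forall>(J :: (('g \<times> 'g set) \<times> 'g set) set) lq' \<phi>.
           subnet_map J lq' I lq \<phi> \<longrightarrow> net_limits J lq' (z \<circ> \<phi>) \<subseteq> X))}"

lemma net_limits_iff:
  assumes "directed_set I lq"
  shows "g \<in> net_limits I lq z \<longleftrightarrow>
    (\<forall>U. open U \<longrightarrow> g \<in> U \<longrightarrow> (\<exists>i\<in>I. \<forall>j\<in>I. lq i j \<longrightarrow> z j \<in> U))"
  by (auto simp: net_limits_def tendsto_def eventually_tail_filter[OF assms])

lemma subnet_limit_frequently: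
  assumes "directed_set I lq" "subnet_map J lq' I lq \<phi>" "y \<in> net_limits J lq' (z \<circ> \<phi>)"
    and "open U" "y \<in> U" "i \<in> I"
  shows "\<exists>k\<in>I. lq i k \<and> z k \<in> U"
proof -
  have J: "directed_set J lq'" using assms by (simp add: subnet_map_def)
  obtain j where j: "j \<in> J" "\<forall>j'\<in>J. lq' j j' \<longrightarrow> z (\<phi> j') \<in> U"
    using assms net_limits_iff[OF J] by (metis comp_apply)
  obtain j1 where j1: "j1 \<in> J" "\<forall>j'\<in>J. lq' j1 j' \<longrightarrow> lq i (\<phi> j')"
    using assms by (auto simp: subnet_map_def)
  obtain j2 where "j2 \<in> J" "lq' j j2" "lq' j1 j2"
    using J j j1 unfolding directed_set_def by meson
  then show ?thesis
    using j j1 assms(2) by (intro bexI[of _ "\<phi> j2"]) (auto simp: subnet_map_def)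
qed

lemma frequently_imp_subnet_limit:
  fixes I :: "'i set" and z :: "'i \<Rightarrow> 'g::topological_space"
  assumes I: "directed_set I lq"
    and y: "\<And>U i. open U \<Longrightarrow> y \<in> U \<Longrightarrow> i \<in> I \<Longrightarrow> \<exists>k\<in>I. lq i k \<and> z k \<in> U"
  shows "\<exists>(J :: ('i \<times> 'g set) set) lq' \<phi>. subnet_map J lq' I lq \<phi> \<and> y \<in> net_limits J lq' (z \<circ> \<phi>)"
proof -
  define J where "J = {(i, U). i \<in> I \<and> open U \<and> y \<in> U \<and> z i \<in> U}"
  define lq' where "lq' = (\<lambda>(i, U::'g set) (j, V). lq i j \<and> V \<subseteq> U)"
  have J: "directed_set J lq'"
    unfolding directed_set_def
  proof (intro conjI ballI impI)
    obtain i where "i \<in> I" using I by (auto simp: directed_set_def)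
    then have "(i, UNIV) \<in> J" by (simp add: J_def)
    then show "J \<noteq> {}" by blast
  next
    fix p assume "p \<in> J"
    then show "lq' p p" using I by (auto simp: J_def lq'_def directed_set_def)
  next
    fix p q s assume pqs: "p \<in> J" "q \<in> J" "s \<in> J" "lq' p q" "lq' q s"
    obtain i U j V k W where [simp]: "p = (i, U)" "q = (j, V)" "s = (k, W)"
      by (cases p, cases q, cases s) auto
    have "i \<in> I" "j \<in> I" "k \<in> I" "lq i j" "lq j k" "W \<subseteq> U"
      using pqs by (auto simp: J_def lq'_def)
    moreover have "lq i k" using I calculation unfolding directed_set_def by blast
    ultimately show "lq' p s" by (simp add: lq'_def)
  next
    fix p q assume pq: "p \<in> J" "q \<in> J"
    obtain i U j V where [simp]: "p = (i, U)" "q = (j, V)" by (cases p, cases q) auto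
    have ij: "i \<in> I" "j \<in> I" "open (U \<inter> V)" "y \<in> U \<inter> V" using pq by (auto simp: J_def)
    obtain k where k: "k \<in> I" "lq i k" "lq j k" using I ij unfolding directed_set_def by meson
    obtain l where l: "l \<in> I" "lq k l" "z l \<in> U \<inter> V" using y[OF ij(3,4) k(1)] by blast
    have "lq i l" "lq j l" using I ij k l unfolding directed_set_def by meson+
    then show "\<exists>s\<in>J. lq' p s \<and> lq' q s"
      using l ij by (intro bexI[of _ "(l, U \<inter> V)"]) (auto simp: J_def lq'_def)
  qed
  have "subnet_map J lq' I lq fst"
    unfolding subnet_map_def
  proof (intro conjI ballI J)
    show "fst ` J \<subseteq> I" by (auto simp: J_def)
    fix i assume "i \<in> I"
    then have "(i, UNIV) \<in> J" by (simp add: J_def)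
    then show "\<exists>j\<in>J. \<forall>j'\<in>J. lq' j j' \<longrightarrow> lq i (fst j')"
      by (intro bexI[of _ "(i, UNIV)"]) (auto simp: lq'_def)
  qed
  moreover have "y \<in> net_limits J lq' (z \<circ> fst)"
    unfolding net_limits_iff[OF J]
  proof (intro allI impI)
    fix U assume U: "open U" "y \<in> U"
    obtain i where "i \<in> I" using I by (auto simp: directed_set_def)
    then obtain k where "k \<in> I" "z k \<in> U" using y[OF U] by blast
    then show "\<exists>i\<in>J. \<forall>j\<in>J. lq' i j \<longrightarrow> (z \<circ> fst) j \<in> U"
      using U by (intro bexI[of _ "(k, U)"]) (auto simp: J_def lq'_def)
  qed
  ultimately show ?thesis by blast
qed

lemma limit_groupsI:
  fixes I :: "'i set" and z :: "'i \<Rightarrow> 'g::topological_space"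
  assumes X: "subgroup X (isotropy_group G x)"
    and I: "directed_set I lq" and zI: "z ` I \<subseteq> Hausdorff_units G"
    and lim: "net_limits I lq z = X"
    and sub: "\<And>(J :: ('i \<times> 'g set) set) lq' \<phi>.
      subnet_map J lq' I lq \<phi> \<Longrightarrow> net_limits J lq' (z \<circ> \<phi>) \<subseteq> X"
  shows "X \<in> limit_groups G x"
proof -
  define tail where "tail = (\<lambda>i. {z j | j. j \<in> I \<and> lq i j})"
  define K where "K = {(g, A). g \<in> A \<and> (\<exists>i\<in>I. A = tail i)}"
  define leK where "leK = (\<lambda>(g::'g, A::'g set) (h::'g, B). B \<subseteq> A)"
  have refl: "lq i i" if "i \<in> I" for i using I that by (auto simp: directed_set_def)
  have trans: "lq i k" if "i \<in> I" "j \<in> I" "k \<in> I" "lq i j" "lq j k" for i j k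
    using I that unfolding directed_set_def by blast
  have z_tail: "(z i, tail i) \<in> K" if "i \<in> I" for i
    using refl that by (auto simp: K_def tail_def)
  have tail_mono: "tail k \<subseteq> tail i" if "i \<in> I" "k \<in> I" "lq i k" for i k
    using trans that unfolding tail_def by blast
  have K: "directed_set K leK"
    unfolding directed_set_def
  proof (intro conjI ballI impI)
    show "K \<noteq> {}" using I z_tail by (auto simp: directed_set_def)
  next
    fix p q assume pq: "p \<in> K" "q \<in> K"
    then obtain i j where ij: "i \<in> I" "j \<in> I" "snd p = tail i" "snd q = tail j"
      by (auto simp: K_def)
    obtain k where k: "k \<in> I" "lq i k" "lq j k" using I ij unfolding directed_set_def by meson
    have "tail k \<subseteq> tail i" "tail k \<subseteq> tail j" using tail_mono ij k by auto
    then show "\<exists>s\<in>K. leK p s \<and> leK q s"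
      using ij z_tail[OF k(1)] by (intro bexI[of _ "(z k, tail k)"]) (auto simp: leK_def)
  qed (auto simp: leK_def)
  have lim_iff: "(\<exists>i\<in>K. \<forall>j\<in>K. leK i j \<longrightarrow> fst j \<in> U) \<longleftrightarrow> (\<exists>i\<in>I. \<forall>j\<in>I. lq i j \<longrightarrow> z j \<in> U)" for U
  proof
    assume "\<exists>i\<in>K. \<forall>j\<in>K. leK i j \<longrightarrow> fst j \<in> U"
    then obtain p where p: "p \<in> K" "\<forall>q\<in>K. leK p q \<longrightarrow> fst q \<in> U" by blast
    then obtain g i where i: "i \<in> I" "p = (g, tail i)" by (auto simp: K_def)
    have "z j \<in> U" if "j \<in> I" "lq i j" for j
      using p(2)[rule_format, OF z_tail[OF that(1)]] tail_mono[OF i(1) that] i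
      by (simp add: leK_def)
    then show "\<exists>i\<in>I. \<forall>j\<in>I. lq i j \<longrightarrow> z j \<in> U" using i by blast
  next
    assume "\<exists>i\<in>I. \<forall>j\<in>I. lq i j \<longrightarrow> z j \<in> U"
    then obtain i where i: "i \<in> I" "\<forall>j\<in>I. lq i j \<longrightarrow> z j \<in> U" by blast
    then have "tail i \<subseteq> U" by (auto simp: tail_def)
    then show "\<exists>i\<in>K. \<forall>j\<in>K. leK i j \<longrightarrow> fst j \<in> U"
      using z_tail[OF i(1)] by (intro bexI[of _ "(z i, tail i)"]) (auto simp: leK_def K_def)
  qed
  have limK: "net_limits K leK fst = X"
    unfolding lim[symmetric]
    by (intro Set.set_eqI) (simp only: net_limits_iff[OF K] net_limits_iff[OF I] lim_iff)
  have "net_limits J lq' (fst \<circ> \<phi>) \<subseteq> X" if J: "subnet_map J lq' K leK \<phi>"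
    for J :: "(('g \<times> 'g set) \<times> 'g set) set" and lq' \<phi>
  proof
    fix y assume y: "y \<in> net_limits J lq' (fst \<circ> \<phi>)"
    have "\<exists>k\<in>I. lq i k \<and> z k \<in> U" if U: "open U" "y \<in> U" "i \<in> I" for U i
    proof -
      obtain g A where gA: "(g, A) \<in> K" "leK (z i, tail i) (g, A)" "g \<in> U"
        using subnet_limit_frequently[OF K J y U(1,2) z_tail[OF U(3)]] by fastforce
      then have "g \<in> tail i" by (auto simp: leK_def K_def)
      then show ?thesis using gA(3) by (auto simp: tail_def)
    qed
    then obtain L :: "('i \<times> 'g set) set" and leL \<psi>
      where "subnet_map L leL I lq \<psi>" "y \<in> net_limits L leL (z \<circ> \<psi>)"
      using frequently_imp_subnet_limit[OF I, of y z] by blast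
    then show "y \<in> X" using sub by blast
  qed
  moreover have "fst ` K \<subseteq> Hausdorff_units G" using zI by (auto simp: K_def tail_def)
  ultimately show ?thesis
    unfolding limit_groups_def mem_Collect_eq
    by (intro conjI X exI[of _ K] exI[of _ leK] exI[of _ fst] K limK allI impI)
qed

lemma limit_groupsE:
  fixes G :: "'g::topological_space groupoid_struct"
  assumes "X \<in> limit_groups G x"
  obtains I :: "('g \<times> 'g set) set" and lq z
  where "subgroup X (isotropy_group G x)" "directed_set I lq" "z ` I \<subseteq> Hausdorff_units G"
    "net_limits I lq z = X"
    "\<And>(J :: 'j set) lq' \<phi>. subnet_map J lq' I lq \<phi> \<Longrightarrow> net_limits J lq' (z \<circ> \<phi>) \<subseteq> X"
proof -
  obtain I :: "('g \<times> 'g set) set" and lq z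
    where *: "subgroup X (isotropy_group G x)" "directed_set I lq" "z ` I \<subseteq> Hausdorff_units G"
      "net_limits I lq z = X"
      and sub: "\<And>(J :: (('g \<times> 'g set) \<times> 'g set) set) lq' \<phi>.
        subnet_map J lq' I lq \<phi> \<Longrightarrow> net_limits J lq' (z \<circ> \<phi>) \<subseteq> X"
    using assms unfolding limit_groups_def by blast
  have "net_limits J lq' (z \<circ> \<phi>) \<subseteq> X" if J: "subnet_map J lq' I lq \<phi>"
    for J :: "'j set" and lq' \<phi>
  proof
    fix y assume y: "y \<in> net_limits J lq' (z \<circ> \<phi>)"
    obtain L :: "(('g \<times> 'g set) \<times> 'g set) set" and leL \<psi>
      where "subnet_map L leL I lq \<psi>" "y \<in> net_limits L leL (z \<circ> \<psi>)"
      using frequently_imp_subnet_limit[OF *(2), of y z]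
        subnet_limit_frequently[OF *(2) J y] by metis
    then show "y \<in> X" using sub by blast
  qed
  with * show thesis by (rule that)
qed


section \<open>The spanning functions\<close>

text \<open>The function \<open>b\<close> on \<open>G\<^sup>x\<^sub>x\<close> is the restriction of a function on \<open>G\<close> whose other values are
  irrelevant.\<close>

definition singular_datum ::
    "'g::topological_space groupoid_struct \<Rightarrow> 'g \<Rightarrow> ('g \<Rightarrow> complex) \<Rightarrow> nat \<Rightarrow> (nat \<Rightarrow> 'g) \<Rightarrow> 'g \<Rightarrow>
     (nat \<Rightarrow> 'g set) \<Rightarrow> bool" where
  "singular_datum G x b n g h V \<longleftrightarrow>
     x \<in> units G \<and>
     inj_on g {1..n} \<and> g ` {1..n} = {\<gamma> \<in> isotropy G x. b \<gamma> \<noteq> 0} \<and>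
     (\<forall>k \<in> isotropy G x. \<forall>X \<in> limit_groups G x.
        (\<Sum>\<gamma> \<in> {\<gamma> \<in> left_coset G k X. b \<gamma> \<noteq> 0}. b \<gamma>) = 0) \<and>
     h \<in> source_fibre G x \<and>
     (\<forall>i\<in>{1..n}. open_bisection G (V i) \<and> h \<cdot>\<^bsub>G\<^esub> g i \<in> V i)"

definition restricted_bisection ::
    "'g groupoid_struct \<Rightarrow> (nat \<Rightarrow> 'g set) \<Rightarrow> 'g set \<Rightarrow> nat \<Rightarrow> 'g set" where
  "restricted_bisection G V W i = V i \<inter> src G -` W"

definition admissible ::
    "'g::topological_space groupoid_struct \<Rightarrow> 'g \<Rightarrow> nat \<Rightarrow> (nat \<Rightarrow> 'g) \<Rightarrow> 'g \<Rightarrow>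
     (nat \<Rightarrow> 'g set) \<Rightarrow> 'g set \<Rightarrow> bool" where
  "admissible G x n g h V W \<longleftrightarrow>
     openin (top_of_set (units G)) W \<and> x \<in> W \<and> (\<forall>i\<in>{1..n}. W \<subseteq> src G ` V i) \<and>
     (\<forall>I. I \<subseteq> {1..n} \<longrightarrow> I \<noteq> {} \<longrightarrow>
        \<not> (\<exists>k \<in> source_fibre G x. \<exists>X \<in> limit_groups G x.
             (\<lambda>i. h \<cdot>\<^bsub>G\<^esub> g i) ` I = left_coset G k X \<inter> (\<lambda>i. h \<cdot>\<^bsub>G\<^esub> g i) ` {1..n}) \<longrightarrow>
        src G ` ((\<Inter>i\<in>I. restricted_bisection G V W i) -
                 (\<Union>j\<in>{1..n} - I. restricted_bisection G V W j)) \<inter> Hausdorff_units G = {})"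

definition singular_function ::
    "'g groupoid_struct \<Rightarrow> ('g \<Rightarrow> complex) \<Rightarrow> nat \<Rightarrow> (nat \<Rightarrow> 'g) \<Rightarrow> (nat \<Rightarrow> 'g set) \<Rightarrow> 'g set \<Rightarrow>
     'g \<Rightarrow> complex" where
  "singular_function G b n g V W =
     (\<lambda>\<gamma>. \<Sum>i=1..n. b (g i) * indicator (restricted_bisection G V W i) \<gamma>)"

end

theory Submission
  imports Defs
begin

text \<open>Over a Hausdorff unit, compact open bisections are relatively closed, so elements of the
  Steinberg algebra are locally constant there. As the set \<open>C\<close> of Hausdorff units is dense (Baire),
  the algebraic singular ideal consists of those \<open>f\<close> in the Steinberg algebra that vanish on
  \<open>s\<^sup>-\<^sup>1(C)\<close>. Near a unit \<open>x\<close> such an \<open>f\<close> is \<open>\<Sum>\<^sub>p f(p) 1\<^bsub>V p\<^esub>\<close> with \<open>p\<close> running through the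
  finite support of \<open>f\<close> in \<open>G\<^sub>x\<close>; evaluating along a net in \<open>C\<close> that defines \<open>X \<in> \<X>(x)\<close>, lifted to
  an arrow \<open>k\<close>, gives \<open>\<Sum>\<^bsub>p \<in> kX\<^esub> f(p) = 0\<close>. Grouping the points \<open>p\<close> by their range writes \<open>f\<close>
  near \<open>x\<close> as a sum of spanning functions, and compactness of the source support globalises this.
  Conversely, along a universal net of units in \<open>C\<close> converging to \<open>x\<close> the limits form a group in
  \<open>\<X>(x)\<close>, which rules out all patterns but cosets and yields admissible neighbourhoods.\<close>


section \<open>Units, isotropy and open bisections\<close>

text \<open>Limits in \<open>G\<close> are not unique, and the proof measures how far they fail to
  be. Two limits k and p of one proper filter of arrows have the same source and the same range, and
  k^{-1}p is then a limit of the sources. Hence if some limit k exists, the limits form the coset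
  kX, where X is the set of limits of the sources. Both directions of the theorem rest on this
  relation. A coset has constant range, so the values of f over x can be sorted by range without
  breaking up any coset sum, and one arrow h for each range moves them into the isotropy group.
  Filters replace nets, which avoids choosing subnets; an ultrafilter plays the part of a universal
  net. The C*-norm disappears early: the coefficients of \<open>regular_rep G f\<close> are the
  values of f, so only the interior of the set where f is nonzero matters. The obstacle in the
  globalisation is that a spanning function needs its base point in W, while pieces of a compact set
  may miss every base point. Differences of two neighbourhoods of the base point supply these
  pieces.\<close>

context groupoid
begin

lemma units_iff: "u \<in> units G \<longleftrightarrow> src G u = u"
  unfolding units_def using src_src by (metis rangeE rangeI)

lemma src_in_units [simp]: "src G g \<in> units G"
  by (simp add: units_def)

lemma rng_in_units [simp]: "rng G g \<in> units G"
  by (simp add: units_iff src_rng)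

lemma src_unit: "u \<in> units G \<Longrightarrow> src G u = u"
  by (simp add: units_iff)

lemma rng_unit: "u \<in> units G \<Longrightarrow> rng G u = u"
  by (metis rng_src units_iff)

lemma inv_unit: "u \<in> units G \<Longrightarrow> ginv G u = u"
  by (metis comp_src inv_comp rng_unit src_inv src_unit)

lemma comp_unit: "src G g = u \<Longrightarrow> g \<cdot> u = g"
  using comp_src by blast

lemma unit_comp: "rng G g = u \<Longrightarrow> u \<cdot> g = g"
  using rng_comp_left by blast

lemma inv_inv [simp]: "ginv G (ginv G g) = g"
  by (metis comp_src comp_assoc inv_comp rng_comp_left rng_inv src_inv)

lemma inv_comp_cancel: "src G g = rng G h \<Longrightarrow> ginv G g \<cdot> (g \<cdot> h) = h"
  by (metis comp_assoc inv_comp rng_comp_left src_inv)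

lemma comp_inv_cancel: "rng G g = rng G h \<Longrightarrow> g \<cdot> (ginv G g \<cdot> h) = h"
  by (metis inv_comp_cancel inv_inv src_inv)

lemma comp_cancel_right: "src G g = src G h \<Longrightarrow> (g \<cdot> ginv G h) \<cdot> h = g"
  by (metis comp_assoc comp_src inv_comp rng_inv src_inv)

lemma comp_left_inj:
  assumes "src G g = rng G h" "src G g = rng G k" "g \<cdot> h = g \<cdot> k"
  shows "h = k"
  by (metis assms inv_comp_cancel)

lemma group_isotropy_group:
  assumes "x \<in> units G"
  shows "group (isotropy_group G x)"
proof (rule groupI)
  fix g assume "g \<in> carrier (isotropy_group G x)"
  then show "\<exists>h\<in>carrier (isotropy_group G x). h \<otimes>\<^bsub>isotropy_group G x\<^esub> g = \<one>\<^bsub>isotropy_group G x\<^esub>"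
    by (intro bexI[of _ "ginv G g"]) (auto simp: isotropy_group_def isotropy_def inv_comp src_inv rng_inv)
qed (use assms in \<open>auto simp: isotropy_group_def isotropy_def src_comp rng_comp comp_assoc
      src_unit rng_unit unit_comp\<close>)

lemma isotropy_inv:
  assumes "x \<in> units G" "g \<in> isotropy G x"
  shows "inv\<^bsub>isotropy_group G x\<^esub> g = ginv G g"
  using assms
  by (intro group.inv_equality[OF group_isotropy_group])
     (auto simp: isotropy_group_def isotropy_def inv_comp src_inv rng_inv)

text \<open>Cosets are handled through k^{-1}p below: when arrows tend to both k and p, their
  sources tend to this element, so membership in kX becomes a statement about limits of
  units.\<close>

lemma left_coset_iff:
  assumes X: "X \<subseteq> isotropy G x" and k: "src G k = x"
  shows "p \<in> left_coset G k X \<longleftrightarrow> rng G p = rng G k \<and> src G p = x \<and> ginv G k \<cdot> p \<in> X"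
proof
  assume "p \<in> left_coset G k X"
  then obtain z where z: "z \<in> X" "p = k \<cdot> z" by (auto simp: left_coset_def)
  then have "rng G z = x" "src G z = x" using X by (auto simp: isotropy_def)
  with z k show "rng G p = rng G k \<and> src G p = x \<and> ginv G k \<cdot> p \<in> X"
    by (simp add: rng_comp src_comp inv_comp_cancel)
next
  assume "rng G p = rng G k \<and> src G p = x \<and> ginv G k \<cdot> p \<in> X"
  then show "p \<in> left_coset G k X"
    unfolding left_coset_def by (metis comp_inv_cancel image_eqI)
qed

end

context topological_groupoid
begin

lemma tendsto_inv: "(f \<longlongrightarrow> g) F \<Longrightarrow> ((\<lambda>a. ginv G (f a)) \<longlongrightarrow> ginv G g) F"
  using continuous_on_tendsto_compose[OF continuous_inv] by auto

lemma tendsto_comp: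
  assumes "(f \<longlongrightarrow> p) F" "(f' \<longlongrightarrow> q) F" "\<forall>\<^sub>F a in F. src G (f a) = rng G (f' a)" "src G p = rng G q"
  shows "((\<lambda>a. f a \<cdot> f' a) \<longlongrightarrow> p \<cdot> q) F"
  using continuous_on_tendsto_compose[OF continuous_comp tendsto_Pair[OF assms(1,2)]] assms(3,4)
  by auto

end

section \<open>Local homeomorphisms\<close>

lemma local_homeomorphism_continuous:
  assumes "local_homeomorphism f Y"
  shows "continuous_on UNIV f"
proof -
  have "continuous_on (\<Union>{U. open U \<and> continuous_on U f}) f"
    by (rule continuous_on_open_Union) auto
  moreover have "x \<in> \<Union>{U. open U \<and> continuous_on U f}" for x
  proof -
    obtain U where "open U" "x \<in> U" "homeomorphic_map (top_of_set U) (top_of_set (f ` U)) f"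
      using assms unfolding local_homeomorphism_def by blast
    moreover from this have "continuous_on U f"
      using homeomorphic_imp_continuous_map continuous_map_in_subtopology by fastforce
    ultimately show ?thesis by blast
  qed
  then have "\<Union>{U. open U \<and> continuous_on U f} = UNIV" by blast
  ultimately show ?thesis by simp
qed

lemma local_homeomorphism_open_image:
  assumes f: "local_homeomorphism f Y" and S: "open S"
  shows "openin (top_of_set Y) (f ` S)"
proof (subst openin_subopen, intro ballI)
  fix y assume "y \<in> f ` S"
  then obtain x where x: "x \<in> S" "y = f x" by blast
  obtain U where U: "open U" "x \<in> U" "openin (top_of_set Y) (f ` U)"
      "homeomorphic_map (top_of_set U) (top_of_set (f ` U)) f"
    using f unfolding local_homeomorphism_def by blast
  have "openin (top_of_set U) (U \<inter> S)" using S by blast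
  then have "openin (top_of_set (f ` U)) (f ` (U \<inter> S))"
    using homeomorphic_imp_open_map[OF U(4)] unfolding open_map_def by blast
  then have "openin (top_of_set Y) (f ` (U \<inter> S))"
    using U(3) openin_trans by blast
  then show "\<exists>T. openin (top_of_set Y) T \<and> y \<in> T \<and> T \<subseteq> f ` S"
    using x U(2) by (intro exI[of _ "f ` (U \<inter> S)"]) auto
qed

section \<open>Topology of the unit space and of bisections\<close>

context etale_groupoid
begin

lemma continuous_src: "continuous_on UNIV (src G)"
  using local_homeomorphism_continuous local_homeo_src by blast

lemma continuous_rng: "continuous_on UNIV (rng G)"
  using local_homeomorphism_continuous local_homeo_rng by blast

lemma tendsto_src: "(f \<longlongrightarrow> g) F \<Longrightarrow> ((\<lambda>a. src G (f a)) \<longlongrightarrow> src G g) F"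
  using continuous_on_tendsto_compose[OF continuous_src] by auto

lemma tendsto_rng: "(f \<longlongrightarrow> g) F \<Longrightarrow> ((\<lambda>a. rng G (f a)) \<longlongrightarrow> rng G g) F"
  using continuous_on_tendsto_compose[OF continuous_rng] by auto

lemma open_src_vimage: "open S \<Longrightarrow> open (src G -` S)"
  using continuous_src open_vimage by blast

text \<open>Near a unit, an arrow and its source both lie in a set on which \<open>src G\<close> is
  injective. They have the same source, so they coincide.\<close>

lemma open_units: "open (units G)"
proof (subst openin_subopen[of euclidean, simplified], intro ballI)
  fix x assume x: "x \<in> units G"
  obtain U where U: "open U" "x \<in> U" "homeomorphic_map (top_of_set U) (top_of_set (src G ` U)) (src G)"
    using local_homeo_src unfolding local_homeomorphism_def by blast
  have inj: "inj_on (src G) U"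
    using homeomorphic_imp_injective_map[OF U(3)] by simp
  have "U \<inter> src G -` U \<subseteq> units G"
    using inj by (auto simp: units_iff src_src inj_on_def)
  then show "\<exists>T. open T \<and> x \<in> T \<and> T \<subseteq> units G"
    using U x by (intro exI[of _ "U \<inter> src G -` U"]) (auto simp: open_src_vimage open_Int src_unit)
qed

lemma openin_units_iff: "openin (top_of_set (units G)) W \<longleftrightarrow> open W \<and> W \<subseteq> units G"
  using openin_open_eq[OF open_units] by auto

lemma open_src_image: "open S \<Longrightarrow> open (src G ` S)"
  using local_homeomorphism_open_image[OF local_homeo_src] openin_units_iff by blast

lemma open_rng_image: "open S \<Longrightarrow> open (rng G ` S)"
  using local_homeomorphism_open_image[OF local_homeo_rng] openin_units_iff by blast

lemma units_separated:
  assumes "u \<in> units G" "v \<in> units G" "u \<noteq> v"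
  obtains A B where "open A" "open B" "u \<in> A" "v \<in> B" "A \<inter> B = {}"
proof -
  obtain A B where "openin (top_of_set (units G)) A" "openin (top_of_set (units G)) B"
      "u \<in> A" "v \<in> B" "disjnt A B"
    using Hausdorff_unit_space assms by (metis Hausdorff_space_def topspace_euclidean_subtopology)
  then show thesis using that openin_units_iff unfolding disjnt_def by metis
qed

text \<open>Only the unit space is Hausdorff. Applied to sources and ranges, this shows that
  different limits of one filter of arrows still have the same source and range.\<close>

lemma tendsto_unit_unique:
  assumes F: "F \<noteq> bot" and lim: "(f \<longlongrightarrow> u) F" "(f \<longlongrightarrow> v) F" and "u \<in> units G" "v \<in> units G"
  shows "u = v"
proof (rule ccontr)
  assume "u \<noteq> v"
  then obtain A B where AB: "open A" "open B" "u \<in> A" "v \<in> B" "A \<inter> B = {}"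
    using units_separated assms by metis
  have "\<forall>\<^sub>F a in F. f a \<in> A" "\<forall>\<^sub>F a in F. f a \<in> B"
    using lim AB topological_tendstoD by blast+
  then have "\<forall>\<^sub>F a in F. False"
    by eventually_elim (use AB in auto)
  then show False using F by simp
qed

lemma compact_units_complement_open:
  assumes "compact K" "K \<subseteq> units G"
  shows "open (units G - K)"
proof -
  have "compactin (top_of_set (units G)) K"
    using assms by (simp add: compactin_subtopology)
  then have "closedin (top_of_set (units G)) K"
    using compactin_imp_closedin Hausdorff_unit_space by blast
  then show ?thesis
    using openin_units_iff by (metis openin_diff openin_subtopology_self)
qed

text \<open>Compact sets of arrows may have a non-compact intersection. Among units, a compact set
  is relatively closed, so the intersection is a compact set minus an open one.\<close>

lemma compact_units_Int:
  assumes "compact K" "compact L" "K \<subseteq> units G" "L \<subseteq> units G"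
  shows "compact (K \<inter> L)"
proof -
  have "K \<inter> L = K - (units G - L)" using assms by auto
  then show ?thesis using compact_diff[OF assms(1) compact_units_complement_open] assms by metis
qed

text \<open>\<open>rng G\<close> and \<open>src G\<close> are continuous and open, so injectivity
  alone makes them homeomorphisms onto their images.\<close>

lemma open_bisection_iff:
  "open_bisection G U \<longleftrightarrow> open U \<and> inj_on (rng G) U \<and> inj_on (src G) U"
proof
  assume "open_bisection G U"
  then show "open U \<and> inj_on (rng G) U \<and> inj_on (src G) U"
    unfolding open_bisection_def using homeomorphic_imp_injective_map by fastforce
next
  assume U: "open U \<and> inj_on (rng G) U \<and> inj_on (src G) U"
  have "homeomorphic_map (top_of_set U) (top_of_set (f ` U)) f"
    if f: "continuous_on UNIV f" "inj_on f U" "\<And>S. open S \<Longrightarrow> open (f ` S)" for f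
  proof (rule bijective_open_imp_homeomorphic_map)
    show "open_map (top_of_set U) (top_of_set (f ` U)) f"
      unfolding open_map_def
    proof (intro allI impI)
      fix S assume "openin (top_of_set U) S"
      then have "open S" "S \<subseteq> U" using U openin_open_eq by blast+
      then show "openin (top_of_set (f ` U)) (f ` S)"
        using f(3) U by (meson image_mono openin_open_eq)
    qed
  qed (use f in \<open>auto intro: continuous_on_subset\<close>)
  then show "open_bisection G U"
    unfolding open_bisection_def
    using U continuous_rng continuous_src open_rng_image open_src_image by blast
qed

lemma open_bisection_subset:
  "open_bisection G U \<Longrightarrow> open V \<Longrightarrow> V \<subseteq> U \<Longrightarrow> open_bisection G V"
  by (auto simp: open_bisection_iff intro: inj_on_subset)

lemma open_bisectionD:
  assumes "open_bisection G U"
  shows "open U" "\<And>g h. g \<in> U \<Longrightarrow> h \<in> U \<Longrightarrow> src G g = src G h \<Longrightarrow> g = h"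
    "\<And>g h. g \<in> U \<Longrightarrow> h \<in> U \<Longrightarrow> rng G g = rng G h \<Longrightarrow> g = h"
  using assms by (auto simp: open_bisection_iff inj_on_def)

text \<open>On V the source map is a homeomorphism onto an open set, so convergence of the sources
  lifts to the arrows. This produces limits throughout, often several for one filter.\<close>

lemma bisection_tendsto:
  assumes V: "open_bisection G V" "v \<in> V" and ev: "\<forall>\<^sub>F a in F. f a \<in> V"
    and lim: "((\<lambda>a. src G (f a)) \<longlongrightarrow> src G v) F"
  shows "(f \<longlongrightarrow> v) F"
proof (rule topological_tendstoI)
  fix S assume S: "open S" "v \<in> S"
  have "open (src G ` (V \<inter> S))" "src G v \<in> src G ` (V \<inter> S)"
    using S V open_bisectionD(1) by (auto intro!: open_src_image)
  then have "\<forall>\<^sub>F a in F. src G (f a) \<in> src G ` (V \<inter> S)"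
    using lim topological_tendstoD by blast
  with ev show "\<forall>\<^sub>F a in F. f a \<in> S"
    by eventually_elim (use open_bisectionD(2)[OF V(1)] in auto)
qed

lemma compact_restricted_bisection:
  assumes V: "open_bisection G V" and W: "compact W" "W \<subseteq> src G ` V"
  shows "compact (V \<inter> src G -` W)"
proof -
  obtain g where g: "homeomorphic_maps (top_of_set V) (top_of_set (src G ` V)) (src G) g"
    using V by (auto simp: open_bisection_def homeomorphic_map_maps)
  then have "continuous_on (src G ` V) g" and gV: "\<And>v. v \<in> V \<Longrightarrow> g (src G v) = v"
    by (auto simp: homeomorphic_maps_def)
  then have "compact (g ` W)"
    using W compact_continuous_image continuous_on_subset by blast
  moreover have "g ` W = V \<inter> src G -` W"
    using W gV by (force simp: image_iff)
  ultimately show ?thesis by simp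
qed

end

section \<open>Compact open neighbourhoods and density of the Hausdorff units\<close>

context ample_groupoid
begin

lemma compact_open_bisection_nbhd:
  assumes "open S" "g \<in> S"
  obtains U where "open_bisection G U" "compact U" "g \<in> U" "U \<subseteq> S"
  by (rule topological_basisE[OF basis assms]) (use that in blast)

lemma compact_open_unit_nbhd:
  assumes "open S" "x \<in> S" "x \<in> units G"
  obtains W where "open W" "compact W" "x \<in> W" "W \<subseteq> S" "W \<subseteq> units G"
proof -
  obtain U where "open_bisection G U" "compact U" "x \<in> U" "U \<subseteq> S \<inter> units G"
    using compact_open_bisection_nbhd[of "S \<inter> units G" x] assms open_units by (metis IntI open_Int)
  then show thesis using that open_bisectionD(1) by blast
qed

text \<open>Baire category: each bisection of the countable cover yields an open dense set of units,
  and a unit in all of them is Hausdorff. Density of \<open>D U\<close> holds because a non-empty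
  open set of units either misses the source image of U, hence its closure, or is the source of
  arrows of U; the open set of these arrows either meets the units or misses their closure.\<close>

lemma Hausdorff_units_dense:
  assumes cov: "countable \<U>" "\<And>U. U \<in> \<U> \<Longrightarrow> open_bisection G U" "\<Union>\<U> = UNIV"
    and S: "open S" "S \<subseteq> units G" "S \<noteq> {}"
  shows "S \<inter> Hausdorff_units G \<noteq> {}"
proof -
  let ?X = "top_of_set (units G)"
  \<comment> \<open>A unit y is in \<open>D U\<close> if it is away from the sources of U, if the
    arrow of U over y is a unit, or if that arrow is outside the closure of the units.\<close>
  define D where "D = (\<lambda>U. (units G - closure (src G ` U)) \<union> src G ` (U \<inter> units G) \<union>
    src G ` (U - closure (units G)))"
  have "?X closure_of (\<Inter>U\<in>\<U>. D U) = topspace ?X"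
  proof (rule Baire_category)
    have "locally_compact_space ?X"
      unfolding locally_compact_space_def
    proof
      fix x assume "x \<in> topspace ?X"
      then obtain W where "open W" "compact W" "x \<in> W" "W \<subseteq> units G"
        using compact_open_unit_nbhd[OF open_units] by (metis topspace_euclidean_subtopology)
      then show "\<exists>U K. openin ?X U \<and> compactin ?X K \<and> x \<in> U \<and> U \<subseteq> K"
        by (intro exI[of _ W]) (auto simp: openin_units_iff compactin_subtopology)
    qed
    then show "completely_metrizable_space ?X \<or> locally_compact_space ?X \<and> regular_space ?X"
      using locally_compact_Hausdorff_imp_regular_space Hausdorff_unit_space by blast
    show "countable (D ` \<U>)" using cov by blast
    fix T assume "T \<in> D ` \<U>"
    then obtain U where U: "U \<in> \<U>" "T = D U" by blast
    have oU: "open U" using cov(2)[OF U(1)] open_bisectionD(1) by blast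
    have "open T"
      unfolding U D_def using oU open_units by (intro open_Un open_src_image open_Diff open_Int) auto
    moreover have "T \<subseteq> units G" unfolding U D_def by auto
    moreover have "units G \<subseteq> ?X closure_of T"
    proof
      fix y assume y: "y \<in> units G"
      show "y \<in> ?X closure_of T"
        unfolding in_closure_of
      proof (intro conjI allI impI)
        fix O' assume "y \<in> O' \<and> openin ?X O'"
        then have O': "y \<in> O'" "open O'" "O' \<subseteq> units G" by (auto simp: openin_units_iff)
        show "\<exists>z. z \<in> T \<and> z \<in> O'"
        proof (cases "O' \<inter> src G ` U = {}")
          case True
          then have "O' \<inter> closure (src G ` U) = {}"
            using O' by (simp add: open_Int_closure_eq_empty)
          then show ?thesis using O' y unfolding U D_def by blast
        next
          case False
          then obtain g where g: "g \<in> U" "src G g \<in> O'" by blast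
          show ?thesis
          proof (cases "U \<inter> src G -` O' \<inter> units G = {}")
            case True
            then have "U \<inter> src G -` O' \<inter> closure (units G) = {}"
              using oU O' open_src_vimage by (simp add: open_Int_closure_eq_empty open_Int)
            then show ?thesis using g unfolding U D_def by blast
          next
            case False
            then show ?thesis unfolding U D_def by blast
          qed
        qed
      qed (use y in simp)
    qed
    ultimately show "openin ?X T \<and> ?X closure_of T = topspace ?X"
      using closure_of_subset_topspace[of ?X T] by (auto simp: openin_units_iff)
  qed
  moreover obtain s where "s \<in> S" using S by blast
  ultimately have "s \<in> ?X closure_of \<Inter>(D ` \<U>)" using S by auto
  then obtain y where y: "y \<in> \<Inter>(D ` \<U>)" "y \<in> S"
    using S \<open>s \<in> S\<close> unfolding in_closure_of openin_units_iff by blast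
  have "y \<in> Hausdorff_units G"
    unfolding Hausdorff_units_def
  proof (intro CollectI conjI ballI)
    show yu: "y \<in> units G" using y S by blast
    fix g assume "g \<in> isotropy G y - {y}"
    then have g: "src G g = y" "g \<noteq> y" by (auto simp: isotropy_def)
    have "g \<in> \<Union>\<U>" using cov(3) by simp
    then obtain U where U: "U \<in> \<U>" "g \<in> U" by blast
    have inj: "g' = g" if "g' \<in> U" "src G g' = y" for g'
      using open_bisectionD(2)[OF cov(2)[OF U(1)] that(1) U(2)] that(2) g(1) by simp
    \<comment> \<open>As g lies in U, the first piece of \<open>D U\<close> is impossible. It is the
      only arrow of U over y and is not a unit, which leaves the third piece.\<close>
    have "y \<in> closure (src G ` U)" using U(2) g(1) by (auto intro: subsetD[OF closure_subset])
    then have "y \<in> src G ` (U \<inter> units G) \<union> src G ` (U - closure (units G))"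
      using y(1) U(1) unfolding D_def by blast
    moreover have "g \<notin> units G" using g src_unit by auto
    ultimately have "g \<notin> closure (units G)" using inj by auto
    then show "\<exists>U. open U \<and> g \<in> U \<and> U \<inter> units G = {}"
      using closure_subset[of "units G"] by (intro exI[of _ "- closure (units G)"]) auto
  qed
  then show ?thesis using y by blast
qed

end

section \<open>Limit groups and admissible neighbourhoods\<close>

text \<open>Zorn's lemma in the reversed order, since finer filters are smaller. A minimal proper
  filter decides every P: restricting it to P gives either the trivial filter or the same filter
  again.\<close>

lemma ultrafilter_below:
  assumes "F \<noteq> bot"
  obtains U where "U \<le> F" "U \<noteq> bot" "\<And>P. eventually P U \<or> eventually (\<lambda>x. \<not> P x) U"
proof -
  let ?A = "{H. H \<le> F \<and> H \<noteq> bot}"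
  have "\<exists>m\<in>?A. \<forall>a\<in>?A. a \<le> m \<longrightarrow> a = m"
  proof (rule predicate_Zorn)
    show "partial_order_on ?A (relation_of (\<lambda>a b. b \<le> a) ?A)"
      by (auto simp: partial_order_on_def preorder_on_def relation_of_def
          intro!: refl_onI transI antisymI)
    fix C assume C: "C \<in> Chains (relation_of (\<lambda>a b. b \<le> a) ?A)"
    show "\<exists>u\<in>?A. \<forall>a\<in>C. u \<le> a"
    proof (cases "C = {}")
      case True
      then show ?thesis using assms by auto
    next
      case False
      have CA: "C \<subseteq> ?A" and tot: "\<And>a b. a \<in> C \<Longrightarrow> b \<in> C \<Longrightarrow> a \<le> b \<or> b \<le> a"
        using C by (auto simp: Chains_def relation_of_def)
      have "Inf C \<noteq> bot"
      proof (rule Inf_filter_not_bot)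
        fix X assume X: "X \<subseteq> C" "finite X"
        \<comment> \<open>By totality, finitely many members of the chain have a member below all of
          them. So finite infima are proper, and hence \<open>Inf C\<close> is.\<close>
        have "\<exists>b\<in>C. b \<le> Inf X"
          using X(2,1)
        proof (induction X rule: finite_induct)
          case empty
          then show ?case using False by auto
        next
          case (insert a X)
          then obtain b where b: "b \<in> C" "b \<le> Inf X" by auto
          have "a \<in> C" using insert.prems by simp
          from tot[OF this b(1)] show ?case
          proof
            assume "a \<le> b"
            then have "a \<le> Inf (insert a X)" using b(2) by auto
            then show ?case using \<open>a \<in> C\<close> by blast
          next
            assume "b \<le> a"
            then have "b \<le> Inf (insert a X)" using b(2) by simp
            then show ?case using b(1) by blast
          qed
        qed
        then obtain b where "b \<in> C" "b \<le> Inf X" by blast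
        moreover from this have "b \<noteq> bot" using CA by blast
        ultimately show "Inf X \<noteq> bot" by (auto simp: bot_unique)
      qed
      moreover obtain a where "a \<in> C" using False by blast
      then have "Inf C \<le> F" using CA Inf_lower2[of a C F] by blast
      ultimately show ?thesis by (intro bexI[of _ "Inf C"]) (auto intro: Inf_lower)
    qed
  qed
  then obtain m where m: "m \<le> F" "m \<noteq> bot" "\<And>a. a \<le> F \<Longrightarrow> a \<noteq> bot \<Longrightarrow> a \<le> m \<Longrightarrow> a = m"
    by auto
  have "eventually P m \<or> eventually (\<lambda>x. \<not> P x) m" for P
  proof (cases "inf m (principal {x. P x}) = bot")
    case True
    then show ?thesis
      by (simp add: trivial_limit_def eventually_inf_principal)
  next
    case False
    then have "inf m (principal {x. P x}) = m"
      using m(1) by (intro m(3)) (auto intro: le_infI1)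
    then have "eventually P (inf m (principal {x. P x})) = eventually P m" by simp
    then show ?thesis by (simp add: eventually_inf_principal)
  qed
  with m that show thesis by blast
qed

text \<open>F collects the eventual values of the net. A limit of a proper filter below F is a
  cluster point of the net, hence a limit of some subnet, so the subnet condition becomes the last
  clause.\<close>

lemma limit_groupsD_filter:
  fixes G :: "'g::topological_space groupoid_struct"
  assumes "X \<in> limit_groups G x"
  obtains F where "subgroup X (isotropy_group G x)" "F \<noteq> bot"
    "\<forall>\<^sub>F y in F. y \<in> Hausdorff_units G" "\<forall>g\<in>X. ((\<lambda>y. y) \<longlongrightarrow> g) F"
    "\<forall>g H. H \<noteq> bot \<longrightarrow> H \<le> F \<longrightarrow> ((\<lambda>y. y) \<longlongrightarrow> g) H \<longrightarrow> g \<in> X"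
proof -
  obtain I :: "('g \<times> 'g set) set" and lq z where X: "subgroup X (isotropy_group G x)"
    and I: "directed_set I lq" and z: "z ` I \<subseteq> Hausdorff_units G" "net_limits I lq z = X"
    and sub: "\<And>(J :: (('g \<times> 'g set) \<times> 'g set) set) lq' \<phi>.
      subnet_map J lq' I lq \<phi> \<Longrightarrow> net_limits J lq' (z \<circ> \<phi>) \<subseteq> X"
    using limit_groupsE[OF assms] by metis
  define F where "F = filtermap z (tail_filter I lq)"
  have ev: "eventually P F \<longleftrightarrow> (\<exists>i\<in>I. \<forall>j\<in>I. lq i j \<longrightarrow> P (z j))" for P
    by (simp add: F_def eventually_filtermap eventually_tail_filter[OF I])
  have I': "I \<noteq> {}" "\<And>i. i \<in> I \<Longrightarrow> lq i i" using I by (auto simp: directed_set_def)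
  have "F \<noteq> bot"
    using I' by (force simp: trivial_limit_def ev)
  moreover have "\<forall>\<^sub>F y in F. y \<in> Hausdorff_units G"
    using z(1) I'(1) unfolding ev by blast
  moreover have "((\<lambda>y. y) \<longlongrightarrow> g) F" if "g \<in> X" for g
    using that unfolding z(2)[symmetric] net_limits_def F_def
    by (simp add: tendsto_def eventually_filtermap)
  moreover have "g \<in> X" if H: "H \<noteq> bot" "H \<le> F" "((\<lambda>y. y) \<longlongrightarrow> g) H" for g H
  proof -
    have "\<exists>k\<in>I. lq i k \<and> z k \<in> U" if U: "open U" "g \<in> U" "i \<in> I" for U i
    proof (rule ccontr)
      assume "\<not> (\<exists>k\<in>I. lq i k \<and> z k \<in> U)"
      then have "\<forall>\<^sub>F y in F. y \<notin> U" using U(3) by (auto simp: ev)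
      then have "\<forall>\<^sub>F y in H. y \<notin> U" using H(2) filter_leD by blast
      moreover have "\<forall>\<^sub>F y in H. y \<in> U" using H(3) U topological_tendstoD by fastforce
      ultimately have "\<forall>\<^sub>F y in H. False" by eventually_elim simp
      then show False using H(1) by simp
    qed
    then obtain J :: "(('g \<times> 'g set) \<times> 'g set) set" and lq' \<phi>
      where "subnet_map J lq' I lq \<phi>" "g \<in> net_limits J lq' (z \<circ> \<phi>)"
      using frequently_imp_subnet_limit[OF I, of g z] by blast
    then show ?thesis using sub by blast
  qed
  ultimately show thesis using that X by blast
qed

text \<open>For an ultrafilter the subnet condition is automatic: the complement of a neighbourhood
  that a subnet enters cannot belong to F, so the neighbourhood does.\<close>

lemma limit_groupsI_ultrafilter:
  fixes G :: "'g::topological_space groupoid_struct"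
  assumes X: "subgroup {g. ((\<lambda>y. y) \<longlongrightarrow> g) F} (isotropy_group G x)"
    and F: "F \<noteq> bot" "\<forall>\<^sub>F y in F. y \<in> Hausdorff_units G"
    and ultra: "\<And>P. eventually P F \<or> eventually (\<lambda>y. \<not> P y) F"
  shows "{g. ((\<lambda>y. y) \<longlongrightarrow> g) F} \<in> limit_groups G x"
proof -
  \<comment> \<open>The canonical net of a filter: members with a chosen point, ordered by reverse
    inclusion. Only members inside the Hausdorff units are taken, so that the net stays
    there.\<close>
  define I where "I = {(y, A). y \<in> A \<and> A \<subseteq> Hausdorff_units G \<and> (\<forall>\<^sub>F y in F. y \<in> A)}"
  define lq where "lq = (\<lambda>(y::'g, A::'g set) (y'::'g, B). B \<subseteq> A)"
  have ne: "\<exists>y. y \<in> A" if "\<forall>\<^sub>F y in F. y \<in> A" for A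
    using eventually_happens'[OF F(1) that] .
  have dir: "directed_set I lq"
    unfolding directed_set_def
  proof (intro conjI ballI impI)
    show "I \<noteq> {}" using ne[OF F(2)] F(2) unfolding I_def by blast
  next
    fix i j assume "i \<in> I" "j \<in> I"
    then obtain y A y' B where [simp]: "i = (y, A)" "j = (y', B)"
      and A: "A \<subseteq> Hausdorff_units G" "\<forall>\<^sub>F y in F. y \<in> A" and B: "\<forall>\<^sub>F y in F. y \<in> B"
      by (auto simp: I_def)
    have AB: "\<forall>\<^sub>F y in F. y \<in> A \<inter> B" using A B by (auto simp: eventually_conj_iff)
    obtain w where "w \<in> A \<inter> B" using ne[OF AB] by blast
    then show "\<exists>k\<in>I. lq i k \<and> lq j k"
      using A AB by (intro bexI[of _ "(w, A \<inter> B)"]) (auto simp: lq_def I_def)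
  qed (auto simp: lq_def)
  have lim_iff: "(\<exists>i\<in>I. \<forall>j\<in>I. lq i j \<longrightarrow> fst j \<in> U) \<longleftrightarrow> (\<forall>\<^sub>F y in F. y \<in> U)" for U
  proof
    assume "\<exists>i\<in>I. \<forall>j\<in>I. lq i j \<longrightarrow> fst j \<in> U"
    then obtain y A where A: "(y, A) \<in> I" "\<forall>j\<in>I. lq (y, A) j \<longrightarrow> fst j \<in> U" by auto
    have "A \<subseteq> U"
    proof
      fix w assume "w \<in> A"
      then have "(w, A) \<in> I" "lq (y, A) (w, A)" using A(1) by (auto simp: I_def lq_def)
      then show "w \<in> U" using A(2) by fastforce
    qed
    then show "\<forall>\<^sub>F y in F. y \<in> U"
      using A(1) by (auto simp: I_def elim: eventually_mono)
  next
    assume U: "\<forall>\<^sub>F y in F. y \<in> U"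
    let ?A = "U \<inter> Hausdorff_units G"
    have ev: "\<forall>\<^sub>F y in F. y \<in> ?A" using U F(2) by eventually_elim simp
    then obtain w where "w \<in> ?A" using ne by blast
    then show "\<exists>i\<in>I. \<forall>j\<in>I. lq i j \<longrightarrow> fst j \<in> U"
      using ev by (intro bexI[of _ "(w, ?A)"]) (auto simp: I_def lq_def)
  qed
  show ?thesis
  proof (rule limit_groupsI[OF X dir])
    show "fst ` I \<subseteq> Hausdorff_units G" by (auto simp: I_def)
    show "net_limits I lq fst = {g. ((\<lambda>y. y) \<longlongrightarrow> g) F}"
      by (auto simp: net_limits_iff[OF dir] lim_iff tendsto_def)
    fix J :: "(('g \<times> 'g set) \<times> 'g set) set" and lq' \<phi>
    assume J: "subnet_map J lq' I lq \<phi>"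
    show "net_limits J lq' (fst \<circ> \<phi>) \<subseteq> {g. ((\<lambda>y. y) \<longlongrightarrow> g) F}"
    proof
      fix g assume g: "g \<in> net_limits J lq' (fst \<circ> \<phi>)"
      have "\<forall>\<^sub>F y in F. y \<in> U" if U: "open U" "g \<in> U" for U
      proof (rule ccontr)
        assume "\<not> (\<forall>\<^sub>F y in F. y \<in> U)"
        then have "\<forall>\<^sub>F y in F. y \<in> - U" using ultra by auto
        then obtain i where i: "i \<in> I" "\<forall>j\<in>I. lq i j \<longrightarrow> fst j \<in> - U"
          using lim_iff by blast
        then show False using subnet_limit_frequently[OF dir J g U i(1)] by auto
      qed
      then show "g \<in> {g. ((\<lambda>y. y) \<longlongrightarrow> g) F}" by (auto simp: tendsto_def)
    qed
  qed
qed

section \<open>Limits of units and admissible patterns\<close>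

context etale_groupoid
begin

lemma Hausdorff_units_subset: "Hausdorff_units G \<subseteq> units G"
  by (auto simp: Hausdorff_units_def)

text \<open>A unit is its own source and range, so the units tend to the source and range of g as
  well. Both are units, hence equal to x.\<close>

lemma limit_of_units_isotropy:
  assumes "F \<noteq> bot" "\<forall>\<^sub>F y in F. y \<in> units G" "x \<in> units G"
    and "((\<lambda>y. y) \<longlongrightarrow> x) F" "((\<lambda>y. y) \<longlongrightarrow> g) F"
  shows "g \<in> isotropy G x"
proof -
  have "((\<lambda>y. y) \<longlongrightarrow> src G g) F" "((\<lambda>y. y) \<longlongrightarrow> rng G g) F"
    using tendsto_src[OF assms(5)] tendsto_rng[OF assms(5)] assms(2)
    by (auto elim!: Lim_transform_eventually eventually_mono simp: src_unit rng_unit)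
  then show ?thesis
    using tendsto_unit_unique[OF assms(1) _ assms(4)] assms(3)
    by (metis (mono_tags, lifting) isotropy_def mem_Collect_eq rng_in_units src_in_units)
qed

text \<open>Units satisfy y = y^{-1} = yy, so continuity of inversion and multiplication makes the
  set of limits closed under both.\<close>

lemma subgroup_limits_of_units:
  assumes F: "F \<noteq> bot" "\<forall>\<^sub>F y in F. y \<in> units G" and x: "x \<in> units G" "((\<lambda>y. y) \<longlongrightarrow> x) F"
  shows "subgroup {g. ((\<lambda>y. y) \<longlongrightarrow> g) F} (isotropy_group G x)"
proof (rule group.subgroupI[OF group_isotropy_group[OF x(1)]])
  show sub: "{g. ((\<lambda>y. y) \<longlongrightarrow> g) F} \<subseteq> carrier (isotropy_group G x)"
    using limit_of_units_isotropy[OF F x] by (auto simp: isotropy_group_def)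
  show "{g. ((\<lambda>y. y) \<longlongrightarrow> g) F} \<noteq> {}" using x by blast
  fix a assume a: "a \<in> {g. ((\<lambda>y. y) \<longlongrightarrow> g) F}"
  have "((\<lambda>y. y) \<longlongrightarrow> ginv G a) F"
    using tendsto_inv[of "\<lambda>y. y" a F] a F(2)
    by (auto elim!: Lim_transform_eventually eventually_mono simp: inv_unit)
  then show "inv\<^bsub>isotropy_group G x\<^esub> a \<in> {g. ((\<lambda>y. y) \<longlongrightarrow> g) F}"
    using isotropy_inv[OF x(1)] a sub by (auto simp: isotropy_group_def)
  fix b assume b: "b \<in> {g. ((\<lambda>y. y) \<longlongrightarrow> g) F}"
  have ab: "src G a = rng G b" using a b sub by (auto simp: isotropy_group_def isotropy_def)
  have ev: "\<forall>\<^sub>F y in F. src G y = rng G y"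
    using F(2) by eventually_elim (simp add: src_unit rng_unit)
  have "((\<lambda>y. y \<cdot> y) \<longlongrightarrow> a \<cdot> b) F"
    using tendsto_comp[OF _ _ ev ab] a b by auto
  then have "((\<lambda>y. y) \<longlongrightarrow> a \<cdot> b) F"
    using F(2) by (auto elim!: Lim_transform_eventually eventually_mono simp: src_unit comp_unit)
  then show "a \<otimes>\<^bsub>isotropy_group G x\<^esub> b \<in> {g. ((\<lambda>y. y) \<longlongrightarrow> g) F}"
    by (simp add: isotropy_group_def)
qed

lemma limit_group_subset: "X \<in> limit_groups G x \<Longrightarrow> X \<subseteq> isotropy G x"
  unfolding limit_groups_def using subgroup.subset by (fastforce simp: isotropy_group_def)

text \<open>A universal net of arrows over Hausdorff units with values in the prescribed bisections
  has a coset of a limit group as its set of limits.\<close>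

lemma coset_pattern_nbhd:
  assumes x: "x \<in> units G"
    and V: "\<And>i. i \<in> N \<Longrightarrow> open_bisection G (V i) \<and> p i \<in> V i \<and> src G (p i) = x \<and> rng G (p i) = r"
    and I: "I \<subseteq> N" "I \<noteq> {}"
    and nc: "\<not> (\<exists>k \<in> source_fibre G x. \<exists>X \<in> limit_groups G x. p ` I = left_coset G k X \<inter> p ` N)"
  obtains S where "open S" "x \<in> S"
    "\<And>\<gamma>. src G \<gamma> \<in> S \<Longrightarrow> src G \<gamma> \<in> Hausdorff_units G \<Longrightarrow> (\<And>i. i \<in> I \<Longrightarrow> \<gamma> \<in> V i) \<Longrightarrow>
      \<exists>j\<in>N - I. \<gamma> \<in> V j"
proof -
  \<comment> \<open>The arrows over Hausdorff units that show the forbidden pattern I. The filter E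
    describes such arrows with sources near x, and the required S exists precisely when E is
    trivial.\<close>
  define A where "A = {\<gamma>. src G \<gamma> \<in> Hausdorff_units G \<and> (\<forall>i\<in>I. \<gamma> \<in> V i) \<and> (\<forall>j\<in>N - I. \<gamma> \<notin> V j)}"
  define E where "E = inf (filtercomap (src G) (nhds x)) (principal A)"
  have "E = bot"
  proof (rule ccontr)
    assume "E \<noteq> bot"
    then obtain U where U: "U \<le> E" "U \<noteq> bot" "\<And>P. eventually P U \<or> eventually (\<lambda>x. \<not> P x) U"
      using ultrafilter_below by blast
    have UA: "\<forall>\<^sub>F \<gamma> in U. \<gamma> \<in> A"
      using U(1) by (simp add: E_def le_principal)
    have Ux: "(src G \<longlongrightarrow> x) U"
      using U(1) by (simp add: E_def filterlim_iff_le_filtercomap)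
    define F where "F = filtermap (src G) U"
    have F: "F \<noteq> bot" "((\<lambda>y. y) \<longlongrightarrow> x) F"
      using U(2) Ux by (simp_all add: F_def filtermap_bot_iff filterlim_def filtermap_filtermap)
    have FC: "\<forall>\<^sub>F y in F. y \<in> Hausdorff_units G"
      using UA by (auto simp: F_def eventually_filtermap A_def elim: eventually_mono)
    have lim_iff: "((\<lambda>y. y) \<longlongrightarrow> g) F \<longleftrightarrow> (src G \<longlongrightarrow> g) U" for g
      by (simp add: F_def filterlim_def filtermap_filtermap)
    define X where "X = {g. ((\<lambda>y. y) \<longlongrightarrow> g) F}"
    have "subgroup X (isotropy_group G x)"
      unfolding X_def using F FC x Hausdorff_units_subset
      by (intro subgroup_limits_of_units) (auto elim: eventually_mono)
    then have X: "X \<in> limit_groups G x"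
      unfolding X_def using F FC U(3)
      by (intro limit_groupsI_ultrafilter) (auto simp: F_def eventually_filtermap)
    obtain i0 where i0: "i0 \<in> I" using I by blast
    define k where "k = p i0"
    have k: "src G k = x" "rng G k = r" using V i0 I by (auto simp: k_def)
    have lim: "((\<lambda>\<gamma>. \<gamma>) \<longlongrightarrow> p i) U" if "i \<in> I" for i
    proof (rule bisection_tendsto[of "V i"])
      have i: "i \<in> N" using that I by blast
      show "open_bisection G (V i)" "p i \<in> V i" using V[OF i] by auto
      show "\<forall>\<^sub>F \<gamma> in U. \<gamma> \<in> V i" using UA by (auto simp: A_def that elim: eventually_mono)
      show "(src G \<longlongrightarrow> src G (p i)) U" using V[OF i] Ux by simp
    qed
    have "p ` I = left_coset G k X \<inter> p ` N"
    proof (intro equalityI subsetI)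
      fix q assume "q \<in> p ` I"
      then obtain i where i: "i \<in> I" "q = p i" by blast
      have iN: "i \<in> N" using i I by blast
      \<comment> \<open>The arrows tend to both k and q, so their sources, written as products of an
        inverse and an arrow, tend to k^{-1}q.\<close>
      have "((\<lambda>\<gamma>. ginv G \<gamma> \<cdot> \<gamma>) \<longlongrightarrow> ginv G k \<cdot> q) U"
        using tendsto_comp[OF tendsto_inv[OF lim[OF i0]] lim[OF i(1)]] V[OF iN] k
        unfolding k_def[symmetric] i(2) by (simp add: src_inv)
      then have "ginv G k \<cdot> q \<in> X"
        by (simp add: X_def lim_iff inv_comp)
      then show "q \<in> left_coset G k X \<inter> p ` N"
        using left_coset_iff[OF limit_group_subset[OF X] k(1)] V[OF iN] k i(2) iN by auto
    next
      fix q assume q: "q \<in> left_coset G k X \<inter> p ` N"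
      then obtain j where j: "j \<in> N" "q = p j" by blast
      have qX: "rng G q = rng G k" "ginv G k \<cdot> q \<in> X"
        using q left_coset_iff[OF limit_group_subset[OF X] k(1)] by auto
      \<comment> \<open>Conversely, an arrow is unchanged by multiplication with its source. The
        arrows tend to k and their sources to k^{-1}q, so the arrows tend to q.\<close>
      have "((\<lambda>\<gamma>. \<gamma> \<cdot> src G \<gamma>) \<longlongrightarrow> k \<cdot> (ginv G k \<cdot> q)) U"
        using tendsto_comp[OF lim[OF i0], of "src G" "ginv G k \<cdot> q"] qX
        by (simp add: k_def[symmetric] X_def lim_iff rng_src rng_comp src_inv rng_inv)
      then have "((\<lambda>\<gamma>. \<gamma>) \<longlongrightarrow> q) U"
        using qX by (simp add: comp_src comp_inv_cancel)
      then have "\<forall>\<^sub>F \<gamma> in U. \<gamma> \<in> V j"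
        using V[OF j(1)] j(2) open_bisectionD(1) topological_tendstoD by fastforce
      \<comment> \<open>The arrows are eventually in \<open>V j\<close>, which the pattern allows
        only for j in I; the statement under the quantifier is constant and U is proper.\<close>
      then have "\<forall>\<^sub>F \<gamma> in U. j \<in> I"
        using UA by eventually_elim (use j in \<open>auto simp: A_def\<close>)
      then show "q \<in> p ` I" using U(2) j(2) by simp
    qed
    then show False using nc X k by (auto simp: source_fibre_def)
  qed
  then have "\<forall>\<^sub>F \<gamma> in filtercomap (src G) (nhds x). \<gamma> \<notin> A"
    by (simp add: E_def trivial_limit_def eventually_inf_principal)
  then obtain S where S: "open S" "x \<in> S" "\<And>\<gamma>. src G \<gamma> \<in> S \<Longrightarrow> \<gamma> \<notin> A"
    unfolding eventually_filtercomap eventually_nhds by blast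
  show thesis
  proof (rule that[OF S(1,2)])
    fix \<gamma> assume "src G \<gamma> \<in> S" "src G \<gamma> \<in> Hausdorff_units G" "\<And>i. i \<in> I \<Longrightarrow> \<gamma> \<in> V i"
    then show "\<exists>j\<in>N - I. \<gamma> \<in> V j" using S(3)[of \<gamma>] by (auto simp: A_def)
  qed
qed

text \<open>The condition is restated for single arrows: the set I of bisections containing an arrow
  over a Hausdorff unit of W must come from a coset. Both the construction of W and the evaluation
  of a spanning function look at one arrow.\<close>

lemma admissible_iff:
  "admissible G x n g h V W \<longleftrightarrow>
     open W \<and> W \<subseteq> units G \<and> x \<in> W \<and> (\<forall>i\<in>{1..n}. W \<subseteq> src G ` V i) \<and>
     (\<forall>I \<gamma>. I \<subseteq> {1..n} \<longrightarrow> I \<noteq> {} \<longrightarrow> src G \<gamma> \<in> W \<longrightarrow> src G \<gamma> \<in> Hausdorff_units G \<longrightarrow>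
        (\<forall>i\<in>I. \<gamma> \<in> V i) \<longrightarrow> (\<forall>j\<in>{1..n} - I. \<gamma> \<notin> V j) \<longrightarrow>
        (\<exists>k \<in> source_fibre G x. \<exists>X \<in> limit_groups G x.
             (\<lambda>i. h \<cdot> g i) ` I = left_coset G k X \<inter> (\<lambda>i. h \<cdot> g i) ` {1..n}))"
proof -
  have *: "src G ` ((\<Inter>i\<in>I. restricted_bisection G V W i) -
      (\<Union>j\<in>{1..n} - I. restricted_bisection G V W j)) \<inter> Hausdorff_units G = {} \<longleftrightarrow>
    (\<forall>\<gamma>. src G \<gamma> \<in> W \<longrightarrow> src G \<gamma> \<in> Hausdorff_units G \<longrightarrow>
        (\<forall>i\<in>I. \<gamma> \<in> V i) \<longrightarrow> \<not> (\<forall>j\<in>{1..n} - I. \<gamma> \<notin> V j))"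
    if "I \<noteq> {}" for I
  proof -
    \<comment> \<open>A member of I is what forces the source of an arrow in the intersection to lie
      in W.\<close>
    obtain i where "i \<in> I" using \<open>I \<noteq> {}\<close> by (metis ex_in_conv)
    then have E: "src G ` ((\<Inter>i\<in>I. restricted_bisection G V W i) -
        (\<Union>j\<in>{1..n} - I. restricted_bisection G V W j)) =
      src G ` {\<gamma>. src G \<gamma> \<in> W \<and> (\<forall>i\<in>I. \<gamma> \<in> V i) \<and> (\<forall>j\<in>{1..n} - I. \<gamma> \<notin> V j)}"
      by (intro arg_cong[where f = "image (src G)"]) (auto simp: restricted_bisection_def)
    show ?thesis unfolding E by (simp add: disjoint_iff) blast
  qed
  show ?thesis
    unfolding admissible_def openin_units_iff using * by (smt (verit))
qed

lemma admissible_subset: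
  assumes "admissible G x n g h V W" "open W'" "x \<in> W'" "W' \<subseteq> W"
  shows "admissible G x n g h V W'"
  using assms unfolding admissible_iff by (smt (verit) subset_iff)

lemma singular_datumD:
  assumes "singular_datum G x b n g h V"
  shows "x \<in> units G" "src G h = x"
    "\<And>i. i \<in> {1..n} \<Longrightarrow> g i \<in> isotropy G x \<and> open_bisection G (V i) \<and> h \<cdot> g i \<in> V i \<and>
      src G (h \<cdot> g i) = x \<and> rng G (h \<cdot> g i) = rng G h"
proof -
  show x: "x \<in> units G" "src G h = x"
    using assms by (auto simp: singular_datum_def source_fibre_def)
  fix i assume i: "i \<in> {1..n}"
  then have "g i \<in> g ` {1..n}" by blast
  then have "g i \<in> isotropy G x" using assms unfolding singular_datum_def by blast
  then show "g i \<in> isotropy G x \<and> open_bisection G (V i) \<and> h \<cdot> g i \<in> V i \<and>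
      src G (h \<cdot> g i) = x \<and> rng G (h \<cdot> g i) = rng G h"
    using assms i x by (simp add: singular_datum_def isotropy_def src_comp rng_comp)
qed

end

context ample_groupoid
begin

text \<open>Only finitely many patterns I have to be excluded, so the neighbourhoods from
  \<open>coset_pattern_nbhd\<close> can be intersected.\<close>

lemma admissible_exists:
  assumes d: "singular_datum G x b n g h V"
  shows "\<exists>W. compact W \<and> admissible G x n g h V W"
proof -
  note D = singular_datumD[OF d]
  let ?N = "{1..n}"
  let ?p = "\<lambda>i. h \<cdot> g i"
  let ?bad = "\<lambda>I. \<not> (\<exists>k \<in> source_fibre G x. \<exists>X \<in> limit_groups G x. ?p ` I = left_coset G k X \<inter> ?p ` ?N)"
  let ?B = "{I. I \<subseteq> ?N \<and> I \<noteq> {} \<and> ?bad I}"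
  define Q where "Q = (\<lambda>I S. \<forall>\<gamma>. src G \<gamma> \<in> S \<longrightarrow> src G \<gamma> \<in> Hausdorff_units G \<longrightarrow>
      (\<forall>i\<in>I. \<gamma> \<in> V i) \<longrightarrow> (\<exists>j\<in>?N - I. \<gamma> \<in> V j))"
  have "\<exists>S. open S \<and> x \<in> S \<and> Q I S" if I: "I \<in> ?B" for I
  proof (rule coset_pattern_nbhd[of x ?N V ?p "rng G h" I])
    show "open_bisection G (V i) \<and> ?p i \<in> V i \<and> src G (?p i) = x \<and> rng G (?p i) = rng G h"
      if "i \<in> ?N" for i using D(3)[OF that] by simp
    show "x \<in> units G" by (rule D(1))
    show "I \<subseteq> ?N" "I \<noteq> {}" "?bad I" using I by simp_all
  qed (auto simp: Q_def)
  then have "\<forall>I\<in>?B. \<exists>S. open S \<and> x \<in> S \<and> Q I S" by (rule ballI)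
  then obtain S where S: "\<forall>I\<in>?B. open (S I) \<and> x \<in> S I \<and> Q I (S I)"
    by (rule bchoice[THEN exE])
  define T where "T = (\<Inter>I\<in>?B. S I) \<inter> (\<Inter>i\<in>?N. src G ` V i)"
  have "finite ?B" by (rule finite_subset[of _ "Pow ?N"]) auto
  then have "open T"
    unfolding T_def using S D(3) open_bisectionD(1)
    by (intro open_Int open_INT) (auto intro: open_src_image)
  moreover have "x \<in> T"
    unfolding T_def
  proof (intro IntI INT_I)
    show "x \<in> S I" if "I \<in> ?B" for I using S that by blast
    show "x \<in> src G ` V i" if "i \<in> ?N" for i using D(3)[OF that] by (intro image_eqI[of _ _ "h \<cdot> g i"]) auto
  qed
  ultimately obtain W where W: "open W" "compact W" "x \<in> W" "W \<subseteq> T" "W \<subseteq> units G"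
    using compact_open_unit_nbhd D(1) by metis
  have "admissible G x n g h V W"
    unfolding admissible_iff
  proof (intro conjI allI impI ballI W)
    show "W \<subseteq> src G ` V i" if "i \<in> ?N" for i using W(4) that unfolding T_def by blast
    fix I \<gamma>
    assume I: "I \<subseteq> ?N" "I \<noteq> {}" and \<gamma>: "src G \<gamma> \<in> W" "src G \<gamma> \<in> Hausdorff_units G"
      "\<forall>i\<in>I. \<gamma> \<in> V i" "\<forall>j\<in>?N - I. \<gamma> \<notin> V j"
    show "\<exists>k \<in> source_fibre G x. \<exists>X \<in> limit_groups G x. ?p ` I = left_coset G k X \<inter> ?p ` ?N"
    proof (rule ccontr)
      assume "?bad I"
      then have IB: "I \<in> ?B" using I by blast
      then have "src G \<gamma> \<in> S I" using W(4) \<gamma>(1) unfolding T_def by blast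
      then show False using bspec[OF S IB] \<gamma> unfolding Q_def by blast
    qed
  qed
  then show ?thesis using W by blast
qed

end

section \<open>The Steinberg algebra over a unit\<close>

lemma cfun_subspaceI:
  fixes A :: "('a \<Rightarrow> complex) set"
  assumes "(\<lambda>_. 0) \<in> A" "\<And>f g. f \<in> A \<Longrightarrow> g \<in> A \<Longrightarrow> (\<lambda>a. f a + g a) \<in> A"
    "\<And>c f. f \<in> A \<Longrightarrow> (\<lambda>a. c * f a) \<in> A"
  shows "cfun.subspace A"
  using assms by (auto simp: cfun.subspace_def plus_fun_def zero_fun_def)

lemma cfun_span_lincomb:
  fixes B :: "('a \<Rightarrow> complex) set"
  assumes "finite I" "\<And>i. i \<in> I \<Longrightarrow> f i \<in> cfun.span B"
  shows "(\<lambda>a. \<Sum>i\<in>I. c i * f i a) \<in> cfun.span B"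
  using assms
proof (induction I rule: finite_induct)
  case empty
  then show ?case using cfun.span_zero[of B] by (simp add: zero_fun_def)
next
  case (insert j I)
  then have "(\<lambda>a. c j * f j a) + (\<lambda>a. \<Sum>i\<in>I. c i * f i a) \<in> cfun.span B"
    by (intro cfun.span_add cfun.span_scale) auto
  then show ?case using insert by (simp add: plus_fun_def)
qed

lemma Steinberg_induct [consumes 1, case_names zero add scale indicator]:
  assumes "f \<in> Steinberg_algebra G"
    and "P (\<lambda>_. 0)" "\<And>f g. P f \<Longrightarrow> P g \<Longrightarrow> P (\<lambda>a. f a + g a)" "\<And>c f. P f \<Longrightarrow> P (\<lambda>a. c * f a)"
    and "\<And>U. open_bisection G U \<Longrightarrow> compact U \<Longrightarrow> P (indicator U)"
  shows "P f"
proof -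
  have "cfun.subspace (Collect P)"
    using assms by (intro cfun_subspaceI) auto
  then show ?thesis
    using assms(1,5) unfolding Steinberg_algebra_def
    by (intro cfun.span_induct[of f _ P]) auto
qed

context ample_groupoid
begin

text \<open>Suppose arrows of U accumulate at g. The compact source image of U is closed among the
  units, so U has an arrow u over the source of g, and the same arrows tend to u. Their sources then
  tend to g^{-1}u, an isotropy element that no open set separates from the units. Over a Hausdorff
  unit it must be trivial, so u = g.\<close>

lemma compact_bisection_closed_over_Hausdorff:
  assumes U: "open_bisection G U" "compact U" and g: "src G g \<in> Hausdorff_units G" "g \<notin> U"
  obtains S where "open S" "g \<in> S" "S \<inter> U = {}"
proof (cases "inf (nhds g) (principal U) = bot")
  case True
  then have "\<forall>\<^sub>F a in nhds g. a \<notin> U"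
    by (simp add: trivial_limit_def eventually_inf_principal)
  then show thesis using that unfolding eventually_nhds by blast
next
  case False
  define F where "F = inf (nhds g) (principal U)"
  have F: "F \<noteq> bot" "((\<lambda>a. a) \<longlongrightarrow> g) F" "\<forall>\<^sub>F a in F. a \<in> U"
    using False by (auto simp: F_def filterlim_def eventually_inf_principal)
  have "src G g \<in> src G ` U"
  proof (rule ccontr)
    assume "src G g \<notin> src G ` U"
    moreover have "open (units G - src G ` U)"
      using U continuous_src
      by (intro compact_units_complement_open compact_continuous_image) (auto intro: continuous_on_subset)
    ultimately have "\<forall>\<^sub>F a in F. src G a \<in> units G - src G ` U"
      using tendsto_src[OF F(2)] topological_tendstoD by fastforce
    with F(3) have "\<forall>\<^sub>F a in F. False" by eventually_elim auto
    then show False using F(1) by simp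
  qed
  then obtain u where u: "u \<in> U" "src G u = src G g" by auto
  have lim: "((\<lambda>a. a) \<longlongrightarrow> u) F"
    using bisection_tendsto[OF U(1) u(1) F(3)] tendsto_src[OF F(2)] u(2) by simp
  have r: "rng G u = rng G g"
    using tendsto_unit_unique[OF F(1) tendsto_rng[OF lim] tendsto_rng[OF F(2)]] by simp
  have "((\<lambda>a. ginv G a \<cdot> a) \<longlongrightarrow> ginv G g \<cdot> u) F"
    using r by (intro tendsto_comp tendsto_inv F(2) lim) (auto simp: src_inv)
  then have lim': "(src G \<longlongrightarrow> ginv G g \<cdot> u) F" by (simp add: inv_comp)
  have iso: "ginv G g \<cdot> u \<in> isotropy G (src G g)"
    using r u by (simp add: isotropy_def rng_comp src_comp src_inv rng_inv)
  have "ginv G g \<cdot> u = src G g"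
  proof (rule ccontr)
    assume "ginv G g \<cdot> u \<noteq> src G g"
    then obtain S where S: "open S" "ginv G g \<cdot> u \<in> S" "S \<inter> units G = {}"
      using g(1) iso unfolding Hausdorff_units_def by blast
    then have "\<forall>\<^sub>F a in F. src G a \<in> S" using lim' topological_tendstoD by blast
    then have "\<forall>\<^sub>F a in F. False" 
      by eventually_elim (use S(3) src_in_units in blast)
    then show False using F(1) by simp
  qed
  then have "g \<cdot> (ginv G g \<cdot> u) = g" by (simp add: comp_src)
  then have "u = g" using r by (simp add: comp_inv_cancel)
  then show thesis using u g by simp
qed

lemma Steinberg_locally_constant:
  assumes "f \<in> Steinberg_algebra G" and g: "src G g \<in> Hausdorff_units G"
  shows "\<forall>\<^sub>F a in nhds g. f a = f g"
  using assms(1)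
proof (induction rule: Steinberg_induct)
  case (add f f')
  then show ?case by eventually_elim simp
next
  case (scale c f)
  then show ?case by eventually_elim simp
next
  case (indicator U)
  show ?case
  proof (cases "g \<in> U")
    case True
    have "\<forall>\<^sub>F a in nhds g. a \<in> U"
      using True indicator open_bisectionD(1) eventually_nhds_in_open by blast
    then show ?thesis by eventually_elim (use True in simp)
  next
    case False
    obtain S where "open S" "g \<in> S" "S \<inter> U = {}"
      using compact_bisection_closed_over_Hausdorff[OF indicator g False] .
    then have "\<forall>\<^sub>F a in nhds g. a \<in> S" "S \<inter> U = {}"
      using eventually_nhds_in_open by blast+
    then show ?thesis by (elim eventually_mono) (use False in \<open>auto simp: indicator_def\<close>)
  qed
qed simp

text \<open>A nonzero value over a Hausdorff unit persists on an open set. In the other direction,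
  the source image of a non-empty open set is open and meets the dense set of Hausdorff
  units.\<close>

lemma Steinberg_empty_interior_iff:
  assumes f: "f \<in> Steinberg_algebra G"
    and dense: "\<And>S. open S \<Longrightarrow> S \<subseteq> units G \<Longrightarrow> S \<noteq> {} \<Longrightarrow> S \<inter> Hausdorff_units G \<noteq> {}"
  shows "interior {g. f g \<noteq> 0} = {} \<longleftrightarrow> (\<forall>g. src G g \<in> Hausdorff_units G \<longrightarrow> f g = 0)"
proof (intro iffI allI impI)
  fix g assume int: "interior {g. f g \<noteq> 0} = {}" and g: "src G g \<in> Hausdorff_units G"
  obtain S where S: "open S" "g \<in> S" "\<And>a. a \<in> S \<Longrightarrow> f a = f g"
    using Steinberg_locally_constant[OF f g] unfolding eventually_nhds by blast
  show "f g = 0"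
  proof (rule ccontr)
    assume "f g \<noteq> 0"
    then have "S \<subseteq> {g. f g \<noteq> 0}" using S(3) by auto
    then show False using interior_maximal[OF _ S(1)] S(2) int by blast
  qed
next
  assume *: "\<forall>g. src G g \<in> Hausdorff_units G \<longrightarrow> f g = 0"
  show "interior {g. f g \<noteq> 0} = {}"
  proof (rule ccontr)
    assume ne: "interior {g. f g \<noteq> 0} \<noteq> {}"
    have "src G ` interior {g. f g \<noteq> 0} \<inter> Hausdorff_units G \<noteq> {}"
      using ne by (intro dense open_src_image) auto
    then show False using * interior_subset by blast
  qed
qed

text \<open>Two open bisections through one arrow p coincide over a neighbourhood of its source, so
  the choice of \<open>V p\<close> is free. A compact bisection with no arrow over x has none over
  units near x. The neighbourhood of x serves the whole fibre over y at once.\<close>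

lemma Steinberg_local_expansion:
  assumes f: "f \<in> Steinberg_algebra G" and x: "x \<in> units G"
    and V: "\<And>p. src G p = x \<Longrightarrow> open_bisection G (V p) \<and> p \<in> V p"
  shows "finite {p. src G p = x \<and> f p \<noteq> 0}"
    and "\<forall>\<^sub>F y in nhds x. \<forall>\<gamma>. src G \<gamma> = y \<longrightarrow>
      f \<gamma> = (\<Sum>p | src G p = x \<and> f p \<noteq> 0. f p * indicator (V p) \<gamma>)"
proof -
  let ?S = "\<lambda>f. {p. src G p = x \<and> f p \<noteq> (0::complex)}"
  let ?E = "\<lambda>f. \<forall>\<^sub>F y in nhds x. \<forall>\<gamma>. src G \<gamma> = y \<longrightarrow> f \<gamma> = (\<Sum>p\<in>?S f. f p * indicator (V p) \<gamma>)"
  have "finite (?S f) \<and> ?E f"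
    using f
  proof (induction rule: Steinberg_induct)
    case (add f f')
    have fin: "finite (?S f \<union> ?S f')" "?S (\<lambda>a. f a + f' a) \<subseteq> ?S f \<union> ?S f'"
      using add by auto
    have "\<forall>\<^sub>F y in nhds x. \<forall>\<gamma>. src G \<gamma> = y \<longrightarrow> f \<gamma> = (\<Sum>p\<in>?S f. f p * indicator (V p) \<gamma>)"
      "\<forall>\<^sub>F y in nhds x. \<forall>\<gamma>. src G \<gamma> = y \<longrightarrow> f' \<gamma> = (\<Sum>p\<in>?S f'. f' p * indicator (V p) \<gamma>)"
      using add by blast+
    then have "?E (\<lambda>a. f a + f' a)"
    proof (eventually_elim, intro allI impI)
      fix y \<gamma> assume *: "\<forall>\<gamma>. src G \<gamma> = y \<longrightarrow> f \<gamma> = (\<Sum>p\<in>?S f. f p * indicator (V p) \<gamma>)"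
        "\<forall>\<gamma>. src G \<gamma> = y \<longrightarrow> f' \<gamma> = (\<Sum>p\<in>?S f'. f' p * indicator (V p) \<gamma>)" "src G \<gamma> = y"
      \<comment> \<open>Values of f and f' may cancel, so all three sums are first extended to the
        union of both supports.\<close>
      have "f \<gamma> = (\<Sum>p\<in>?S f \<union> ?S f'. f p * indicator (V p) \<gamma>)"
        using * fin(1) by (simp, intro sum.mono_neutral_left) auto
      moreover have "f' \<gamma> = (\<Sum>p\<in>?S f \<union> ?S f'. f' p * indicator (V p) \<gamma>)"
        using * fin(1) by (simp, intro sum.mono_neutral_left) auto
      moreover have "(\<Sum>p\<in>?S (\<lambda>a. f a + f' a). (f p + f' p) * indicator (V p) \<gamma>) =
          (\<Sum>p\<in>?S f \<union> ?S f'. (f p + f' p) * indicator (V p) \<gamma>)"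
        using fin by (intro sum.mono_neutral_left) auto
      ultimately show "f \<gamma> + f' \<gamma> = (\<Sum>p\<in>?S (\<lambda>a. f a + f' a). (f p + f' p) * indicator (V p) \<gamma>)"
        by (simp add: distrib_right sum.distrib)
    qed
    then show ?case using fin finite_subset by blast
  next
    case (scale c f)
    show ?case
    proof (cases "c = 0")
      case False
      then have eq: "?S (\<lambda>a. c * f a) = ?S f" by simp
      have "\<forall>\<^sub>F y in nhds x. \<forall>\<gamma>. src G \<gamma> = y \<longrightarrow> f \<gamma> = (\<Sum>p\<in>?S f. f p * indicator (V p) \<gamma>)"
        using scale by blast
      then have "?E (\<lambda>a. c * f a)"
        unfolding eq by eventually_elim (auto simp: sum_distrib_left mult.assoc)
      then show ?thesis using scale eq by simp
    qed simp
  next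
    case (indicator U)
    note UD = open_bisectionD[OF indicator(1)]
    show ?case
    proof (cases "x \<in> src G ` U")
      case True
      then obtain u where u: "u \<in> U" "src G u = x" by blast
      have eq: "?S (indicator U) = {u}"
        using u UD(2) by (auto simp: indicator_def split: if_splits)
      note VD = open_bisectionD[OF conjunct1[OF V[OF u(2)]]]
      \<comment> \<open>Over this neighbourhood of x, the bisections U and \<open>V u\<close>
        contain the same arrow.\<close>
      have "open (src G ` (U \<inter> V u))"
        using UD(1) VD(1) by (intro open_src_image open_Int)
      moreover have "x \<in> src G ` (U \<inter> V u)" using u V by blast
      ultimately have "\<forall>\<^sub>F y in nhds x. y \<in> src G ` (U \<inter> V u)"
        by (rule eventually_nhds_in_open)
      then have "\<forall>\<^sub>F y in nhds x. \<forall>\<gamma>. src G \<gamma> = y \<longrightarrow>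
          indicator U \<gamma> = (indicator U u * indicator (V u) \<gamma> :: complex)"
      proof (eventually_elim, intro allI impI)
        fix y \<gamma> assume "y \<in> src G ` (U \<inter> V u)" "src G \<gamma> = y"
        then obtain \<gamma>' where "\<gamma>' \<in> U" "\<gamma>' \<in> V u" "src G \<gamma>' = src G \<gamma>" by auto
        then have "\<gamma> \<in> U \<longleftrightarrow> \<gamma> \<in> V u" using UD(2) VD(2) by metis
        then show "indicator U \<gamma> = (indicator U u * indicator (V u) \<gamma> :: complex)"
          using u by (simp add: indicator_def)
      qed
      then show ?thesis
        unfolding eq by (simp only: sum.insert sum.empty finite.emptyI finite.insertI empty_iff simp_thms add_0_right)
    next
      case False
      then have eq: "?S (indicator U) = {}" by (auto simp: indicator_def)
      have "open (units G - src G ` U)"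
        using indicator continuous_src
        by (intro compact_units_complement_open compact_continuous_image) (auto intro: continuous_on_subset)
      then have "\<forall>\<^sub>F y in nhds x. y \<in> units G - src G ` U"
        using False x by (intro eventually_nhds_in_open) auto
      then show ?thesis unfolding eq
        by (auto elim!: eventually_mono simp: indicator_def)
    qed
  qed simp
  then show "finite (?S f)" "?E f" by blast+
qed

text \<open>A bisection meets each range fibre at most once. This makes the sums defining
  convolution finite.\<close>

lemma finite_Steinberg_rng_fibre:
  assumes "f \<in> Steinberg_algebra G"
  shows "finite {p. rng G p = y \<and> f p \<noteq> 0}"
  using assms
proof (induction rule: Steinberg_induct)
  case (add f f')
  have "{p. rng G p = y \<and> f p + f' p \<noteq> 0} \<subseteq> {p. rng G p = y \<and> f p \<noteq> 0} \<union> {p. rng G p = y \<and> f' p \<noteq> 0}"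
    by auto
  then show ?case using add finite_subset by blast
next
  case (scale c f)
  then show ?case by (elim rev_finite_subset) auto
next
  case (indicator U)
  have "\<exists>u. {p. rng G p = y \<and> indicator U p \<noteq> (0::complex)} \<subseteq> {u}"
    using open_bisectionD(3)[OF indicator(1)] by (auto simp: indicator_def split: if_splits)
  then show ?case by (meson finite.simps finite_subset)
qed simp

text \<open>Along the filter F that defines X, arrows lifted near k are eventually in
  \<open>V p\<close> exactly for p in kX. The local expansion of f there is the coset sum, while f
  is zero over Hausdorff units.\<close>

lemma coset_sum_zero:
  assumes f: "f \<in> Steinberg_algebra G" and f0: "\<And>g. src G g \<in> Hausdorff_units G \<Longrightarrow> f g = 0"
    and X: "X \<in> limit_groups G x" and x: "x \<in> units G" and k: "src G k = x"
  shows "(\<Sum>p | p \<in> left_coset G k X \<and> f p \<noteq> 0. f p) = 0"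
proof -
  obtain F where sub: "subgroup X (isotropy_group G x)" and F: "F \<noteq> bot"
    "\<forall>\<^sub>F y in F. y \<in> Hausdorff_units G" "\<forall>g\<in>X. ((\<lambda>y. y) \<longlongrightarrow> g) F"
    "\<forall>g H. H \<noteq> bot \<longrightarrow> H \<le> F \<longrightarrow> ((\<lambda>y. y) \<longlongrightarrow> g) H \<longrightarrow> g \<in> X"
    by (rule limit_groupsD_filter[OF X])
  have Fx: "((\<lambda>y. y) \<longlongrightarrow> x) F"
    using bspec[OF F(3)] subgroup.one_closed[OF sub] by (simp add: isotropy_group_def)
  have Fu: "\<forall>\<^sub>F y in F. y \<in> units G"
    using F(2) by eventually_elim (use Hausdorff_units_subset in blast)
  have "\<exists>U. open_bisection G U \<and> p \<in> U" for p
    using compact_open_bisection_nbhd[OF open_UNIV UNIV_I] by metis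
  then obtain V where V: "\<And>p. open_bisection G (V p)" "\<And>p. p \<in> V p" by metis
  let ?P = "{p. src G p = x \<and> f p \<noteq> 0}"
  have fin: "finite ?P" and ex: "\<forall>\<^sub>F y in nhds x. \<forall>\<gamma>. src G \<gamma> = y \<longrightarrow>
      f \<gamma> = (\<Sum>p\<in>?P. f p * indicator (V p) \<gamma>)"
    using Steinberg_local_expansion[OF f x, of V] V by blast+
  \<comment> \<open>The local section of the source map through k, which lifts units near x to
    arrows near k.\<close>
  define c where "c = inv_into (V k) (src G)"
  have c: "c y \<in> V k \<and> src G (c y) = y" if "y \<in> src G ` V k" for y
    using that by (simp add: c_def inv_into_into f_inv_into_f)
  have "\<forall>\<^sub>F y in F. y \<in> src G ` V k"
    using Fx open_src_image[OF open_bisectionD(1)[OF V(1)]] V(2) k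
    by (intro topological_tendstoD[OF Fx]) auto
  then have cV: "\<forall>\<^sub>F y in F. c y \<in> V k" and cs: "\<forall>\<^sub>F y in F. src G (c y) = y"
    by (rule eventually_mono, use c in blast)+
  \<comment> \<open>Stated for every H below F because the case of p outside the coset passes to the
    part of F on which the lift stays in \<open>V p\<close>.\<close>
  have bis: "(c \<longlongrightarrow> p) H" if "H \<le> F" "src G p = x" "\<forall>\<^sub>F y in H. c y \<in> V p" for p H
  proof (rule bisection_tendsto[OF V that(3)])
    have "\<forall>\<^sub>F y in H. y = src G (c y)" using filter_leD[OF that(1) cs] by eventually_elim simp
    moreover have "((\<lambda>y. y) \<longlongrightarrow> x) H" using Fx that(1) tendsto_mono by blast
    ultimately show "((\<lambda>y. src G (c y)) \<longlongrightarrow> src G p) H"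
      using that(2) Lim_transform_eventually by fastforce
  qed
  have ck: "(c \<longlongrightarrow> k) H" if "H \<le> F" for H
    using bis[OF that k filter_leD[OF that cV]] .
  note lc = left_coset_iff[OF limit_group_subset[OF X] k]
  have mem: "\<forall>\<^sub>F y in F. c y \<in> V p \<longleftrightarrow> p \<in> left_coset G k X" if p: "p \<in> ?P" for p
  proof (cases "p \<in> left_coset G k X")
    case True
    then have q: "rng G p = rng G k" "ginv G k \<cdot> p \<in> X" using lc by auto
    have "\<forall>\<^sub>F y in F. src G (c y) = rng G y"
      using cs Fu by eventually_elim (simp add: rng_unit)
    then have "((\<lambda>y. c y \<cdot> y) \<longlongrightarrow> k \<cdot> (ginv G k \<cdot> p)) F"
      using q by (intro tendsto_comp ck bspec[OF F(3)]) (auto simp: rng_comp src_inv rng_inv)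
    moreover have "\<forall>\<^sub>F y in F. c y \<cdot> y = c y"
      using cs by eventually_elim (simp add: comp_unit)
    ultimately have "(c \<longlongrightarrow> p) F"
      using q by (simp add: comp_inv_cancel Lim_transform_eventually)
    then have "\<forall>\<^sub>F y in F. c y \<in> V p"
      using V open_bisectionD(1) topological_tendstoD by blast
    then show ?thesis using True by (auto elim: eventually_mono)
  next
    case False
    have "\<forall>\<^sub>F y in F. c y \<notin> V p"
    proof (rule ccontr)
      assume neg: "\<not> (\<forall>\<^sub>F y in F. c y \<notin> V p)"
      \<comment> \<open>If the lifts return to \<open>V p\<close> again and again, they tend along H
        to both k and p. Then k^{-1}p is a limit of units along a filter finer than F, hence in
        X.\<close>
      define H where "H = inf F (principal {y. c y \<in> V p})"
      have H: "H \<noteq> bot" "H \<le> F" "\<forall>\<^sub>F y in H. c y \<in> V p"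
        using neg by (auto simp: H_def trivial_limit_def eventually_inf_principal)
      have p': "src G p = x" using p by simp
      have lim: "(c \<longlongrightarrow> k) H" "(c \<longlongrightarrow> p) H"
        using ck bis H p' by blast+
      have r: "rng G k = rng G p"
        using tendsto_unit_unique[OF H(1) tendsto_rng[OF lim(1)] tendsto_rng[OF lim(2)]] by simp
      have "((\<lambda>y. ginv G (c y) \<cdot> c y) \<longlongrightarrow> ginv G k \<cdot> p) H"
        using r by (intro tendsto_comp tendsto_inv lim) (auto simp: src_inv)
      moreover have "\<forall>\<^sub>F y in H. ginv G (c y) \<cdot> c y = y"
        using filter_leD[OF H(2) cs] by eventually_elim (simp add: inv_comp)
      ultimately have "((\<lambda>y. y) \<longlongrightarrow> ginv G k \<cdot> p) H"
        by (rule Lim_transform_eventually)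
      then show False using F(4) H False lc r p' by auto
    qed
    then show ?thesis using False by (auto elim: eventually_mono)
  qed
  have "\<forall>\<^sub>F y in F. \<forall>p\<in>?P. c y \<in> V p \<longleftrightarrow> p \<in> left_coset G k X"
    using fin mem by (intro eventually_ball_finite) auto
  moreover have "\<forall>\<^sub>F y in F. \<forall>\<gamma>. src G \<gamma> = y \<longrightarrow> f \<gamma> = (\<Sum>p\<in>?P. f p * indicator (V p) \<gamma>)"
    using Fx by (intro filter_leD[OF _ ex]) (simp add: filterlim_def filtermap_ident)
  ultimately have "\<forall>\<^sub>F y in F. (\<Sum>p | p \<in> left_coset G k X \<and> f p \<noteq> 0. f p) = 0"
    using cs F(2)
  proof eventually_elim
    case (elim y)
    have "0 = f (c y)" using f0 elim by simp
    also have "\<dots> = (\<Sum>p\<in>?P. f p * indicator (V p) (c y))" using elim by blast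
    also have "\<dots> = (\<Sum>p\<in>?P. if p \<in> left_coset G k X then f p else 0)"
      using elim(1) by (intro sum.cong) (auto simp: indicator_def)
    also have "\<dots> = (\<Sum>p\<in>{p\<in>?P. p \<in> left_coset G k X}. f p)"
      by (rule sum.inter_filter[OF fin, symmetric])
    also have "{p\<in>?P. p \<in> left_coset G k X} = {p. p \<in> left_coset G k X \<and> f p \<noteq> 0}"
      using lc by auto
    finally show ?case by simp
  qed
  then show ?thesis using F(1) by simp
qed

end

section \<open>The reduced norm\<close>

lemma infsum_eq_single:
  fixes f :: "'a \<Rightarrow> 'b::{comm_monoid_add, t2_space}"
  assumes "a \<in> A" "\<And>b. b \<in> A \<Longrightarrow> b \<noteq> a \<Longrightarrow> f b = 0"
  shows "infsum f A = f a"
proof -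
  have "infsum f A = infsum f {a}"
    by (rule infsum_cong_neutral) (use assms in auto)
  then show ?thesis by simp
qed

lemma Steinberg_indicator: "open_bisection G U \<Longrightarrow> compact U \<Longrightarrow> indicator U \<in> Steinberg_algebra G"
  unfolding Steinberg_algebra_def by (intro cfun.span_base) blast

lemma Steinberg_zero: "(\<lambda>_. 0) \<in> Steinberg_algebra G"
  unfolding Steinberg_algebra_def using cfun.span_zero by (simp add: zero_fun_def)

lemma Steinberg_add:
  "f \<in> Steinberg_algebra G \<Longrightarrow> f' \<in> Steinberg_algebra G \<Longrightarrow> (\<lambda>a. f a + f' a) \<in> Steinberg_algebra G"
  unfolding Steinberg_algebra_def using cfun.span_add by (simp add: plus_fun_def)

lemma Steinberg_scale: "f \<in> Steinberg_algebra G \<Longrightarrow> (\<lambda>a. c * f a) \<in> Steinberg_algebra G"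
  unfolding Steinberg_algebra_def using cfun.span_scale by blast

lemma Steinberg_subset_Connes: "Steinberg_algebra G \<subseteq> Connes_algebra G"
  unfolding Steinberg_algebra_def Connes_algebra_def
proof (rule cfun.span_mono, clarify)
  fix U assume U: "open_bisection G U" "compact U"
  have "continuous_on U (indicator U :: 'a \<Rightarrow> complex)"
    by (rule continuous_on_eq[OF continuous_on_const[of _ 1]]) simp
  moreover have "U \<inter> closure {g \<in> U. indicator U g \<noteq> (0::complex)} = U"
    using closure_subset[of U] by (auto simp: indicator_def)
  ultimately show "\<exists>V. open_bisection G V \<and> continuous_on V (indicator U :: 'a \<Rightarrow> complex) \<and>
      compact (V \<inter> closure {g \<in> V. indicator U g \<noteq> (0::complex)}) \<and>
      (\<forall>g. g \<notin> V \<longrightarrow> indicator U g = (0::complex))"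
    using U by (intro exI[of _ U]) auto
qed

lemma ell2_zero: "(\<lambda>_. 0) \<in> ell2 G x"
  by (simp add: ell2_def)

lemma ell2_scale: "\<xi> \<in> ell2 G x \<Longrightarrow> (\<lambda>g. c * \<xi> g) \<in> ell2 G x"
  by (auto simp: ell2_def norm_mult power_mult_distrib intro: summable_on_cmult_right)

text \<open>A crude substitute for the triangle inequality in ell2: only some uniform operator bound
  is wanted, so the factors 2 are harmless.\<close>

lemma cmod_add_squared_le: "(cmod (a + b))\<^sup>2 \<le> 2 * (cmod a)\<^sup>2 + 2 * (cmod b)\<^sup>2"
proof -
  have "(cmod (a + b))\<^sup>2 \<le> (cmod a + cmod b)\<^sup>2"
    by (simp add: norm_triangle_ineq power_mono)
  also have "\<dots> \<le> 2 * (cmod a)\<^sup>2 + 2 * (cmod b)\<^sup>2"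
    using zero_le_power2[of "cmod a - cmod b"] by (simp add: power2_eq_square algebra_simps)
  finally show ?thesis .
qed

lemma ell2_add:
  assumes \<xi>: "\<xi> \<in> ell2 G x" and \<eta>: "\<eta> \<in> ell2 G x"
  shows "(\<lambda>g. \<xi> g + \<eta> g) \<in> ell2 G x"
    and "(\<Sum>\<^sub>\<infinity>g\<in>source_fibre G x. (cmod (\<xi> g + \<eta> g))\<^sup>2) \<le>
      2 * (\<Sum>\<^sub>\<infinity>g\<in>source_fibre G x. (cmod (\<xi> g))\<^sup>2) + 2 * (\<Sum>\<^sub>\<infinity>g\<in>source_fibre G x. (cmod (\<eta> g))\<^sup>2)"
proof -
  have s: "(\<lambda>g. 2 * (cmod (\<xi> g))\<^sup>2) summable_on source_fibre G x"
    "(\<lambda>g. 2 * (cmod (\<eta> g))\<^sup>2) summable_on source_fibre G x"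
    using \<xi> \<eta> by (auto simp: ell2_def intro: summable_on_cmult_right)
  note s2 = summable_on_add[OF s]
  have s3: "(\<lambda>g. (cmod (\<xi> g + \<eta> g))\<^sup>2) summable_on source_fibre G x"
    by (rule summable_on_comparison_test[OF s2]) (auto simp: cmod_add_squared_le)
  show "(\<lambda>g. \<xi> g + \<eta> g) \<in> ell2 G x"
    using \<xi> \<eta> s3 by (auto simp: ell2_def)
  have "(\<Sum>\<^sub>\<infinity>g\<in>source_fibre G x. (cmod (\<xi> g + \<eta> g))\<^sup>2) \<le>
      (\<Sum>\<^sub>\<infinity>g\<in>source_fibre G x. 2 * (cmod (\<xi> g))\<^sup>2 + 2 * (cmod (\<eta> g))\<^sup>2)"
    by (rule infsum_mono[OF s3 s2]) (rule cmod_add_squared_le)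
  also have "\<dots> = 2 * (\<Sum>\<^sub>\<infinity>g\<in>source_fibre G x. (cmod (\<xi> g))\<^sup>2) + 2 * (\<Sum>\<^sub>\<infinity>g\<in>source_fibre G x. (cmod (\<eta> g))\<^sup>2)"
    using s by (simp add: infsum_add infsum_cmult_right')
  finally show "(\<Sum>\<^sub>\<infinity>g\<in>source_fibre G x. (cmod (\<xi> g + \<eta> g))\<^sup>2) \<le>
      2 * (\<Sum>\<^sub>\<infinity>g\<in>source_fibre G x. (cmod (\<xi> g))\<^sup>2) + 2 * (\<Sum>\<^sub>\<infinity>g\<in>source_fibre G x. (cmod (\<eta> g))\<^sup>2)" .
qed

lemma conv_zero: "\<xi> \<in> ell2 G x \<Longrightarrow> src G g \<noteq> x \<Longrightarrow> conv G f \<xi> g = 0"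
  unfolding conv_def by (rule infsum_0) (auto simp: ell2_def source_fibre_def)

section \<open>Convolution operators of Steinberg functions\<close>

context ample_groupoid
begin

text \<open>The map taking h to the argument of f is injective into one range fibre, where f has
  finite support. The sum is thus finite for every \<xi>, which gives additivity of convolution in
  both arguments.\<close>

lemma summable_conv:
  assumes "f \<in> Steinberg_algebra G"
  shows "(\<lambda>h. f (g \<cdot> ginv G h) * \<xi> h) summable_on source_fibre G (src G g)"
proof (rule finite_nonzero_values_imp_summable_on)
  let ?A = "{h \<in> source_fibre G (src G g). f (g \<cdot> ginv G h) * \<xi> h \<noteq> 0}"
  have "inj_on (\<lambda>h. g \<cdot> ginv G h) ?A"
  proof (rule inj_onI)
    fix h h' assume *: "h \<in> ?A" "h' \<in> ?A" "g \<cdot> ginv G h = g \<cdot> ginv G h'"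
    then have "ginv G h = ginv G h'"
      by (intro comp_left_inj[OF _ _ *(3)]) (use *(1,2) in \<open>auto simp: source_fibre_def rng_inv\<close>)
    then show "h = h'" by (metis inv_inv)
  qed
  moreover have "(\<lambda>h. g \<cdot> ginv G h) ` ?A \<subseteq> {p. rng G p = rng G g \<and> f p \<noteq> 0}"
    by (auto simp: source_fibre_def rng_comp rng_inv)
  ultimately show "finite ?A"
    using finite_Steinberg_rng_fibre[OF assms] inj_on_finite by blast
qed

lemma conv_add_left:
  assumes "f \<in> Steinberg_algebra G" "f' \<in> Steinberg_algebra G"
  shows "conv G (\<lambda>a. f a + f' a) \<xi> = (\<lambda>g. conv G f \<xi> g + conv G f' \<xi> g)"
  unfolding conv_def using assms summable_conv
  by (simp add: fun_eq_iff distrib_right infsum_add)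

lemma conv_scale_left: "conv G (\<lambda>a. c * f a) \<xi> = (\<lambda>g. c * conv G f \<xi> g)"
  unfolding conv_def by (simp add: mult.assoc infsum_cmult_right')

lemma conv_add_right:
  assumes "f \<in> Steinberg_algebra G"
  shows "conv G f (\<lambda>a. \<xi> a + \<eta> a) = (\<lambda>g. conv G f \<xi> g + conv G f \<eta> g)"
  unfolding conv_def using assms summable_conv
  by (simp add: fun_eq_iff distrib_left infsum_add)

lemma conv_scale_right: "conv G f (\<lambda>a. c * \<xi> a) = (\<lambda>g. c * conv G f \<xi> g)"
  unfolding conv_def by (simp add: mult.left_commute infsum_cmult_right')

lemma conv_indicator_unit:
  assumes "src G g = x"
  shows "conv G f (indicator {x}) g = f g"
proof -
  have x: "x \<in> units G" using assms by auto
  have "conv G f (indicator {x}) g = f (g \<cdot> ginv G x) * indicator {x} x"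
    unfolding conv_def using x assms src_unit
    by (subst infsum_eq_single[of x]) (auto simp: source_fibre_def indicator_def)
  then show ?thesis using x assms by (simp add: inv_unit comp_unit)
qed

text \<open>The indicator of a bisection acts as a partial isometry: its convolution with \<xi> at g
  is \<xi> at c^{-1}g, where c is the arrow of U with the range of g, and zero if there is none.
  This reindexing is injective.\<close>

lemma conv_indicator_bound:
  assumes U: "open_bisection G U" and \<xi>: "\<xi> \<in> ell2 G x"
  shows "conv G (indicator U) \<xi> \<in> ell2 G x"
    and "(\<Sum>\<^sub>\<infinity>g\<in>source_fibre G x. (cmod (conv G (indicator U) \<xi> g))\<^sup>2) \<le>
      (\<Sum>\<^sub>\<infinity>g\<in>source_fibre G x. (cmod (\<xi> g))\<^sup>2)"
proof -
  let ?E = "source_fibre G x"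
  note UD = open_bisectionD[OF U]
  define c where "c = inv_into U (rng G)"
  have c: "c y \<in> U \<and> rng G (c y) = y" if "y \<in> rng G ` U" for y
    using that by (simp add: c_def inv_into_into f_inv_into_f)
  define A where "A = {g \<in> ?E. rng G g \<in> rng G ` U}"
  define \<phi> where "\<phi> = (\<lambda>g. ginv G (c (rng G g)) \<cdot> g)"
  have \<phi>: "rng G (\<phi> g) = src G (c (rng G g))" "src G (\<phi> g) = x" "c (rng G g) \<cdot> \<phi> g = g"
    "c (rng G g) \<in> U" if "g \<in> A" for g
    using that c[of "rng G g"]
    by (auto simp: A_def \<phi>_def source_fibre_def rng_comp src_comp src_inv rng_inv comp_inv_cancel)
  have conv_A: "conv G (indicator U) \<xi> g = \<xi> (\<phi> g)" if g: "g \<in> A" for g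
  proof -
    have gx: "src G g = x" using g by (simp add: A_def source_fibre_def)
    have "g \<cdot> ginv G (\<phi> g) = c (rng G g)"
      using \<phi>[OF g] comp_assoc[of "c (rng G g)" "\<phi> g" "ginv G (\<phi> g)"]
      by (simp add: rng_inv comp_inv comp_src)
    moreover have "g \<cdot> ginv G h \<notin> U" if h: "h \<in> ?E" "h \<noteq> \<phi> g" for h
    proof
      assume "g \<cdot> ginv G h \<in> U"
      moreover have "rng G (g \<cdot> ginv G h) = rng G g"
        using h gx by (simp add: source_fibre_def rng_comp rng_inv)
      ultimately have "c (rng G g) = g \<cdot> ginv G h"
        using UD(3) c[of "rng G g"] \<phi>(4)[OF g] g by (simp add: A_def)
      moreover have "(g \<cdot> ginv G h) \<cdot> h = g"
        using h gx by (simp add: source_fibre_def comp_cancel_right)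
      moreover have "src G (g \<cdot> ginv G h) = rng G h"
        using h gx by (simp add: source_fibre_def src_comp rng_inv src_inv)
      ultimately have "\<phi> g = h" unfolding \<phi>_def using inv_comp_cancel by metis
      then show False using h by simp
    qed
    ultimately show ?thesis
      unfolding conv_def gx using \<phi>[OF g]
      by (subst infsum_eq_single[of "\<phi> g"]) (auto simp: source_fibre_def indicator_def)
  qed
  have conv_nA: "conv G (indicator U) \<xi> g = 0" if g: "g \<in> ?E" "g \<notin> A" for g
    unfolding conv_def
  proof (rule infsum_0)
    fix h assume h: "h \<in> source_fibre G (src G g)"
    then have "rng G (g \<cdot> ginv G h) = rng G g" by (simp add: source_fibre_def rng_comp rng_inv)
    then have "g \<cdot> ginv G h \<notin> U" using g by (auto simp: A_def image_iff)
    then show "indicator U (g \<cdot> ginv G h) * \<xi> h = 0" by simp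
  qed
  have inj: "inj_on \<phi> A"
  proof (rule inj_onI)
    fix g g' assume *: "g \<in> A" "g' \<in> A" "\<phi> g = \<phi> g'"
    then have "src G (c (rng G g)) = src G (c (rng G g'))"
      using \<phi>(1)[OF *(1)] \<phi>(1)[OF *(2)] by simp
    then have "c (rng G g) = c (rng G g')"
      by (rule UD(2)[OF \<phi>(4)[OF *(1)] \<phi>(4)[OF *(2)]])
    then have "c (rng G g) \<cdot> \<phi> g = c (rng G g') \<cdot> \<phi> g'" using *(3) by simp
    then show "g = g'" unfolding \<phi>(3)[OF *(1)] \<phi>(3)[OF *(2)] .
  qed
  have img: "\<phi> ` A \<subseteq> ?E" using \<phi>(2) by (auto simp: source_fibre_def)
  have sE: "(\<lambda>g. (cmod (\<xi> g))\<^sup>2) summable_on ?E" using \<xi> by (simp add: ell2_def)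
  have sA: "(\<lambda>g. (cmod (\<xi> g))\<^sup>2) summable_on \<phi> ` A"
    using summable_on_subset[OF sE img] .
  have s: "(\<lambda>g. (cmod (conv G (indicator U) \<xi> g))\<^sup>2) summable_on ?E \<longleftrightarrow>
      ((\<lambda>g. (cmod (\<xi> g))\<^sup>2) \<circ> \<phi>) summable_on A"
    by (rule summable_on_cong_neutral) (auto simp: conv_A conv_nA A_def)
  have i: "(\<Sum>\<^sub>\<infinity>g\<in>?E. (cmod (conv G (indicator U) \<xi> g))\<^sup>2) = infsum ((\<lambda>g. (cmod (\<xi> g))\<^sup>2) \<circ> \<phi>) A"
    by (rule infsum_cong_neutral) (auto simp: conv_A conv_nA A_def)
  show "conv G (indicator U) \<xi> \<in> ell2 G x"
    using s sA summable_on_reindex[OF inj] conv_zero[OF \<xi>] by (auto simp: ell2_def source_fibre_def)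
  show "(\<Sum>\<^sub>\<infinity>g\<in>?E. (cmod (conv G (indicator U) \<xi> g))\<^sup>2) \<le> (\<Sum>\<^sub>\<infinity>g\<in>?E. (cmod (\<xi> g))\<^sup>2)"
    unfolding i infsum_reindex[OF inj, symmetric]
    by (rule infsum_mono2[OF sA sE img]) simp
qed

lemma conv_Steinberg_bound:
  assumes "f \<in> Steinberg_algebra G"
  shows "\<exists>M\<ge>0. \<forall>x. \<forall>\<xi>\<in>ell2 G x. conv G f \<xi> \<in> ell2 G x \<and>
    (\<Sum>\<^sub>\<infinity>g\<in>source_fibre G x. (cmod (conv G f \<xi> g))\<^sup>2) \<le> M * (\<Sum>\<^sub>\<infinity>g\<in>source_fibre G x. (cmod (\<xi> g))\<^sup>2)"
proof -
  define N where "N = (\<lambda>x \<xi>. \<Sum>\<^sub>\<infinity>g\<in>source_fibre G x. (cmod (\<xi> g))\<^sup>2)"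
  define B where "B = (\<lambda>f M. 0 \<le> M \<and> (\<forall>x. \<forall>\<xi>\<in>ell2 G x. conv G f \<xi> \<in> ell2 G x \<and> N x (conv G f \<xi>) \<le> M * N x \<xi>))"
  \<comment> \<open>Membership is carried along the induction because \<open>conv_add_left\<close>
    needs it for both summands. The bound M is for squared norms and does not depend on x.\<close>
  have "f \<in> Steinberg_algebra G \<and> (\<exists>M. B f M)"
    using assms
  proof (induction rule: Steinberg_induct)
    case zero
    have "conv G (\<lambda>_. 0) \<xi> = (\<lambda>_. 0)" for \<xi> by (simp add: conv_def fun_eq_iff)
    then have "B (\<lambda>_. 0) 0" by (simp add: B_def N_def ell2_zero)
    then show ?case using Steinberg_zero by blast
  next
    case (add f f')
    then obtain M M' where f: "f \<in> Steinberg_algebra G" "f' \<in> Steinberg_algebra G"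
      and B: "B f M" "B f' M'" by blast
    have "conv G (\<lambda>a. f a + f' a) \<xi> \<in> ell2 G x \<and>
        N x (conv G (\<lambda>a. f a + f' a) \<xi>) \<le> (2 * M + 2 * M') * N x \<xi>" if \<xi>: "\<xi> \<in> ell2 G x" for x \<xi>
    proof -
      have mem: "conv G f \<xi> \<in> ell2 G x" "conv G f' \<xi> \<in> ell2 G x"
        and le: "N x (conv G f \<xi>) \<le> M * N x \<xi>" "N x (conv G f' \<xi>) \<le> M' * N x \<xi>"
        using B \<xi> unfolding B_def by blast+
      have "N x (conv G (\<lambda>a. f a + f' a) \<xi>) \<le> 2 * N x (conv G f \<xi>) + 2 * N x (conv G f' \<xi>)"
        unfolding N_def conv_add_left[OF f] by (rule ell2_add(2)[OF mem])
      moreover have "conv G (\<lambda>a. f a + f' a) \<xi> \<in> ell2 G x"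
        unfolding conv_add_left[OF f] by (rule ell2_add(1)[OF mem])
      ultimately show ?thesis using le by (simp add: distrib_right)
    qed
    then have "B (\<lambda>a. f a + f' a) (2 * M + 2 * M')"
      using B by (simp add: B_def)
    then show ?case using Steinberg_add[OF f] by blast
  next
    case (scale c f)
    then obtain M where f: "f \<in> Steinberg_algebra G" and B: "B f M" by blast
    have "conv G (\<lambda>a. c * f a) \<xi> \<in> ell2 G x \<and>
        N x (conv G (\<lambda>a. c * f a) \<xi>) \<le> ((cmod c)\<^sup>2 * M) * N x \<xi>" if \<xi>: "\<xi> \<in> ell2 G x" for x \<xi>
    proof -
      have mem: "conv G f \<xi> \<in> ell2 G x" and le: "N x (conv G f \<xi>) \<le> M * N x \<xi>"
        using B \<xi> unfolding B_def by blast+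
      have "N x (conv G (\<lambda>a. c * f a) \<xi>) = (cmod c)\<^sup>2 * N x (conv G f \<xi>)"
        by (simp add: N_def conv_scale_left norm_mult power_mult_distrib infsum_cmult_right')
      then show ?thesis
        using ell2_scale[OF mem] mult_left_mono[OF le, of "(cmod c)\<^sup>2"]
        by (simp add: conv_scale_left mult.assoc)
    qed
    then have "B (\<lambda>a. c * f a) ((cmod c)\<^sup>2 * M)"
      using B by (simp add: B_def)
    then show ?case using Steinberg_scale[OF f] by blast
  next
    case (indicator U)
    have "B (indicator U) 1"
      using conv_indicator_bound[OF indicator(1)] by (simp add: B_def N_def)
    then show ?case using Steinberg_indicator[OF indicator] by blast
  qed
  then show ?thesis unfolding B_def N_def by blast
qed

lemma regular_rep_bounded:
  assumes f: "f \<in> Steinberg_algebra G"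
  shows "regular_rep G f \<in> bounded_operator_families G"
proof -
  obtain M where M: "M \<ge> 0" "\<And>x \<xi>. \<xi> \<in> ell2 G x \<Longrightarrow> conv G f \<xi> \<in> ell2 G x"
    "\<And>x \<xi>. \<xi> \<in> ell2 G x \<Longrightarrow> (\<Sum>\<^sub>\<infinity>g\<in>source_fibre G x. (cmod (conv G f \<xi> g))\<^sup>2) \<le>
      M * (\<Sum>\<^sub>\<infinity>g\<in>source_fibre G x. (cmod (\<xi> g))\<^sup>2)"
    using conv_Steinberg_bound[OF f] by meson
  have "ell2_norm G x (conv G f \<xi>) \<le> sqrt M * ell2_norm G x \<xi>" if "\<xi> \<in> ell2 G x" for x \<xi>
    unfolding ell2_norm_def real_sqrt_mult[symmetric] using M(3)[OF that] by simp
  moreover have "conv G f (\<xi> + \<eta>) = conv G f \<xi> + conv G f \<eta>" for \<xi> \<eta>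
    using conv_add_right[OF f] by (simp add: plus_fun_def)
  moreover have "\<xi> + \<eta> \<in> ell2 G x" if "\<xi> \<in> ell2 G x" "\<eta> \<in> ell2 G x" for \<xi> \<eta> x
    using ell2_add(1)[OF that] by (simp add: plus_fun_def)
  ultimately show ?thesis
    unfolding bounded_operator_families_def regular_rep_def
    using M(2) by (auto simp: conv_scale_right ell2_scale)
qed

lemma as_function_regular_rep: "as_function G (regular_rep G f) g = f g"
proof -
  define x where "x = src G g"
  have x: "x \<in> units G" by (simp add: x_def)
  have "indicator {x} \<in> ell2 G x"
  proof -
    have "finite {g \<in> source_fibre G x. (cmod (indicator {x} g))\<^sup>2 \<noteq> 0}"
      by (rule finite_subset[of _ "{x}"]) (auto simp: indicator_def)
    then show ?thesis
      using x src_unit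
      by (auto simp: ell2_def source_fibre_def indicator_def intro!: finite_nonzero_values_imp_summable_on)
  qed
  then have "as_function G (regular_rep G f) g = ell2_inner G x (conv G f (indicator {x})) (indicator {g})"
    using x by (simp add: as_function_def regular_rep_def x_def[symmetric])
  also have "\<dots> = conv G f (indicator {x}) g"
    unfolding ell2_inner_def
    by (subst infsum_eq_single[of g]) (auto simp: source_fibre_def x_def indicator_def)
  also have "\<dots> = f g" using conv_indicator_unit x_def by simp
  finally show ?thesis .
qed

lemma operator_family_norm_zero: "operator_family_norm G 0 = 0"
proof -
  \<comment> \<open>The supremum of a constant is that constant only over a non-empty set.\<close>
  have "x \<in> units G \<Longrightarrow> (\<lambda>_. 0) \<in> ell2 G x \<and> ell2_norm G x (\<lambda>_. 0) \<le> 1" for x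
    by (simp add: ell2_zero ell2_norm_def)
  then have ne: "{(x, \<xi>). x \<in> units G \<and> \<xi> \<in> ell2 G x \<and> ell2_norm G x \<xi> \<le> 1} \<noteq> {}"
    using src_in_units by blast
  have "operator_family_norm G 0 =
      (SUP p \<in> {(x, \<xi>). x \<in> units G \<and> \<xi> \<in> ell2 G x \<and> ell2_norm G x \<xi> \<le> 1}. 0)"
    unfolding operator_family_norm_def
    by (intro arg_cong[where f = Sup] image_cong) (auto simp: ell2_norm_def)
  then show ?thesis using ne by simp
qed

text \<open>A Steinberg function approximates itself at distance 0, and its coefficients in the
  regular representation are its values; no trace of the norm remains.\<close>

lemma algebraic_singular_ideal_iff:
  "f \<in> algebraic_singular_ideal G \<longleftrightarrow> f \<in> Steinberg_algebra G \<and> interior {g. f g \<noteq> 0} = {}"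
proof -
  have "regular_rep G f \<in> reduced_Cstar G" if f: "f \<in> Steinberg_algebra G"
    unfolding reduced_Cstar_def
    using regular_rep_bounded[OF f] Steinberg_subset_Connes f operator_family_norm_zero
    by (auto intro!: bexI[of _ f])
  then show ?thesis
    by (auto simp: algebraic_singular_ideal_def singular_ideal_def as_function_regular_rep)
qed

end

section \<open>The singular ideal as a linear span\<close>

text \<open>For a set W of units this is the convolution of f with the indicator of W.\<close>

definition cutoff :: "'g groupoid_struct \<Rightarrow> ('g \<Rightarrow> complex) \<Rightarrow> 'g set \<Rightarrow> 'g \<Rightarrow> complex" where
  "cutoff G f W = (\<lambda>\<gamma>. f \<gamma> * indicator W (src G \<gamma>))"

definition singular_functions :: "'g::topological_space groupoid_struct \<Rightarrow> ('g \<Rightarrow> complex) set" where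
  "singular_functions G = {singular_function G b n g V W | x b n g h V W.
     singular_datum G x b n g h V \<and> compact W \<and> admissible G x n g h V W}"

context ample_groupoid
begin

lemma singular_function_Steinberg:
  assumes d: "singular_datum G x b n g h V" and W: "compact W" "admissible G x n g h V W"
  shows "singular_function G b n g V W \<in> Steinberg_algebra G"
proof -
  have "indicator (restricted_bisection G V W i) \<in> Steinberg_algebra G" if i: "i \<in> {1..n}" for i
  proof (rule Steinberg_indicator)
    have V: "open_bisection G (V i)" using singular_datumD(3)[OF d i] by blast
    have "open W" "W \<subseteq> src G ` V i" using W(2) i by (auto simp: admissible_iff)
    then have "open (V i \<inter> src G -` W)" "compact (V i \<inter> src G -` W)"
      using compact_restricted_bisection[OF V W(1)] open_bisectionD(1)[OF V]
      by (simp_all add: open_src_vimage open_Int)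
    then show "compact (restricted_bisection G V W i)" "open_bisection G (restricted_bisection G V W i)"
      using open_bisection_subset[OF V] by (simp_all add: restricted_bisection_def)
  qed
  then show ?thesis
    unfolding singular_function_def Steinberg_algebra_def by (intro cfun_span_lincomb) auto
qed

text \<open>The value at \<gamma> is the sum of \<open>b (g i)\<close> over the pattern I of
  \<gamma>. Admissibility makes a non-empty pattern the trace of a coset kX; translated by h^{-1} it
  is a coset in the isotropy group, over which b sums to zero.\<close>

lemma singular_function_vanishes:
  assumes d: "singular_datum G x b n g h V" and W: "admissible G x n g h V W"
    and \<gamma>: "src G \<gamma> \<in> Hausdorff_units G"
  shows "singular_function G b n g V W \<gamma> = 0"
proof -
  note D = singular_datumD[OF d]
  define I where "I = {i \<in> {1..n}. \<gamma> \<in> restricted_bisection G V W i}"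
  have inj: "inj_on g {1..n}" and supp: "g ` {1..n} = {\<gamma> \<in> isotropy G x. b \<gamma> \<noteq> 0}"
    and sum0: "\<And>k X. k \<in> isotropy G x \<Longrightarrow> X \<in> limit_groups G x \<Longrightarrow>
      (\<Sum>\<gamma> \<in> {\<gamma> \<in> left_coset G k X. b \<gamma> \<noteq> 0}. b \<gamma>) = 0"
    using d unfolding singular_datum_def by blast+
  have "singular_function G b n g V W \<gamma> = (\<Sum>i\<in>{1..n}. if \<gamma> \<in> restricted_bisection G V W i then b (g i) else 0)"
    unfolding singular_function_def by (intro sum.cong) (auto simp: indicator_def)
  also have "\<dots> = (\<Sum>i\<in>I. b (g i))"
    unfolding I_def by (rule sum.inter_filter[symmetric]) simp
  also have "\<dots> = 0"
  proof (cases "I = {}")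
    case False
    then obtain i0 where i0: "i0 \<in> I" by blast
    have "src G \<gamma> \<in> W" using i0 by (simp add: I_def restricted_bisection_def)
    then have "\<exists>k \<in> source_fibre G x. \<exists>X \<in> limit_groups G x.
        (\<lambda>i. h \<cdot> g i) ` I = left_coset G k X \<inter> (\<lambda>i. h \<cdot> g i) ` {1..n}"
      using W \<gamma> False unfolding admissible_iff
      by (elim conjE allE[of _ I] allE[of _ \<gamma>]) (auto simp: I_def restricted_bisection_def)
    then obtain k X where k: "src G k = x" and X: "X \<in> limit_groups G x"
      and eq: "(\<lambda>i. h \<cdot> g i) ` I = left_coset G k X \<inter> (\<lambda>i. h \<cdot> g i) ` {1..n}"
      by (auto simp: source_fibre_def)
    note Xi = limit_group_subset[OF X]
    have IN: "I \<subseteq> {1..n}" by (auto simp: I_def)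
    \<comment> \<open>The coset contains some product of h with a \<open>g i\<close>, so k and h
      have the same range and h^{-1}k is a genuine product.\<close>
    have r: "rng G k = rng G h"
    proof -
      have "h \<cdot> g i0 \<in> left_coset G k X" using eq i0 by blast
      then show ?thesis using left_coset_iff[OF Xi k] D(3) i0 IN by (metis subsetD)
    qed
    define k' where "k' = ginv G h \<cdot> k"
    have k': "k' \<in> isotropy G x" "h \<cdot> k' = k"
      using r k D by (simp_all add: k'_def isotropy_def rng_comp src_comp src_inv rng_inv comp_inv_cancel)
    have coset: "h \<cdot> p \<in> left_coset G k X \<longleftrightarrow> p \<in> left_coset G k' X" if p: "p \<in> isotropy G x" for p
    proof -
      have "ginv G k \<cdot> (h \<cdot> p) = ginv G k' \<cdot> p"
      proof (rule comp_left_inj[of k])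
        have pk: "rng G p = x" "src G k' = x" "rng G k' = x" using p k' by (auto simp: isotropy_def)
        show "src G k = rng G (ginv G k \<cdot> (h \<cdot> p))" "src G k = rng G (ginv G k' \<cdot> p)"
          using pk D r k by (simp_all add: rng_comp src_inv rng_inv)
        have "k \<cdot> (ginv G k' \<cdot> p) = h \<cdot> (k' \<cdot> (ginv G k' \<cdot> p))"
          unfolding k'(2)[symmetric] using pk D by (intro comp_assoc) (simp_all add: rng_comp rng_inv src_inv)
        then show "k \<cdot> (ginv G k \<cdot> (h \<cdot> p)) = k \<cdot> (ginv G k' \<cdot> p)"
          using pk D r by (simp add: comp_inv_cancel rng_comp)
      qed
      then show ?thesis
        using left_coset_iff[OF Xi k] left_coset_iff[OF Xi, of k'] p k' r D
        by (simp add: isotropy_def rng_comp src_comp)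
    qed
    have gi: "g i \<in> isotropy G x" if "i \<in> {1..n}" for i using D(3)[OF that] by blast
    \<comment> \<open>The products of h with the \<open>g i\<close> are distinct, so the equation
      between sets of arrows can be read off index by index.\<close>
    have inj': "i = j" if "i \<in> {1..n}" "j \<in> {1..n}" "h \<cdot> g i = h \<cdot> g j" for i j
    proof -
      have "g i = g j"
        using gi[OF that(1)] gi[OF that(2)] D(2) by (intro comp_left_inj[OF _ _ that(3)]) (auto simp: isotropy_def)
      then show ?thesis using inj_onD[OF inj _ that(1,2)] by blast
    qed
    have I_iff: "i \<in> I \<longleftrightarrow> g i \<in> left_coset G k' X" if i: "i \<in> {1..n}" for i
    proof -
      have "i \<in> I \<longleftrightarrow> h \<cdot> g i \<in> (\<lambda>i. h \<cdot> g i) ` I"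
        using inj'[OF i] IN by (blast intro: subsetD)
      also have "\<dots> \<longleftrightarrow> h \<cdot> g i \<in> left_coset G k X" unfolding eq using i by blast
      also have "\<dots> \<longleftrightarrow> g i \<in> left_coset G k' X" using coset gi[OF i] by blast
      finally show ?thesis .
    qed
    have "left_coset G k' X \<subseteq> isotropy G x"
      using left_coset_iff[OF Xi, of k'] k'(1) by (auto simp: isotropy_def)
    then have img: "g ` I = {\<gamma> \<in> left_coset G k' X. b \<gamma> \<noteq> 0}"
    proof (intro equalityI subsetI)
      fix \<gamma> assume "\<gamma> \<in> g ` I"
      then obtain i where "i \<in> I" "\<gamma> = g i" by blast
      moreover have "g i \<in> g ` {1..n}" using \<open>i \<in> I\<close> IN by blast
      ultimately show "\<gamma> \<in> {\<gamma> \<in> left_coset G k' X. b \<gamma> \<noteq> 0}"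
        using I_iff[of i] IN supp by auto
    next
      fix \<gamma> assume \<gamma>: "\<gamma> \<in> {\<gamma> \<in> left_coset G k' X. b \<gamma> \<noteq> 0}"
      then have "\<gamma> \<in> g ` {1..n}" using \<open>left_coset G k' X \<subseteq> isotropy G x\<close> unfolding supp by blast
      then obtain i where "i \<in> {1..n}" "\<gamma> = g i" by blast
      then show "\<gamma> \<in> g ` I" using I_iff[of i] \<gamma> by blast
    qed
    have "(\<Sum>i\<in>I. b (g i)) = (\<Sum>\<gamma>\<in>g ` I. b \<gamma>)"
      using inj_on_subset[OF inj IN] by (simp add: sum.reindex)
    then show ?thesis unfolding img using sum0[OF k'(1) X] by simp
  qed simp
  finally show ?thesis .
qed

text \<open>Left translation by h is a bijection from the isotropy group onto the arrows of source x
  with the range of h, and it carries kX to (hk)X. So \<open>coset_sum_zero\<close> at hk gives the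
  coset condition for the translate of f.\<close>

lemma fibre_singular_datum:
  assumes f: "f \<in> Steinberg_algebra G" and f0: "\<And>g. src G g \<in> Hausdorff_units G \<Longrightarrow> f g = 0"
    and x: "x \<in> units G" and h: "src G h = x"
    and V: "\<And>p. open_bisection G (V p)" "\<And>p. p \<in> V p"
  shows "\<exists>n g. singular_datum G x (\<lambda>\<gamma>. f (h \<cdot> \<gamma>)) n g h (\<lambda>i. V (h \<cdot> g i)) \<and>
    (\<forall>W. singular_function G (\<lambda>\<gamma>. f (h \<cdot> \<gamma>)) n g (\<lambda>i. V (h \<cdot> g i)) W =
      cutoff G (\<lambda>\<gamma>. \<Sum>p | src G p = x \<and> f p \<noteq> 0 \<and> rng G p = rng G h. f p * indicator (V p) \<gamma>) W)"
proof -
  let ?B = "{\<gamma> \<in> isotropy G x. f (h \<cdot> \<gamma>) \<noteq> 0}"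
  let ?Q = "{p. src G p = x \<and> f p \<noteq> 0 \<and> rng G p = rng G h}"
  have inj: "inj_on (\<lambda>\<gamma>. h \<cdot> \<gamma>) (isotropy G x)"
  proof (rule inj_onI)
    fix a b assume ab: "a \<in> isotropy G x" "b \<in> isotropy G x" and eq: "h \<cdot> a = h \<cdot> b"
    show "a = b" by (rule comp_left_inj[OF _ _ eq]) (use ab h in \<open>auto simp: isotropy_def\<close>)
  qed
  have hB: "h \<cdot> \<gamma> \<in> ?Q" if "\<gamma> \<in> ?B" for \<gamma>
    using that h by (auto simp: isotropy_def src_comp rng_comp)
  have hQ: "p \<in> (\<lambda>\<gamma>. h \<cdot> \<gamma>) ` ?B" if "p \<in> ?Q" for p
  proof (rule image_eqI)
    have p: "src G p = x" "f p \<noteq> 0" "rng G h = rng G p" using that by auto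
    then show "p = h \<cdot> (ginv G h \<cdot> p)" by (simp add: comp_inv_cancel)
    with p h show "ginv G h \<cdot> p \<in> ?B"
      by (simp add: isotropy_def src_comp rng_comp src_inv rng_inv)
  qed
  have bij: "bij_betw (\<lambda>\<gamma>. h \<cdot> \<gamma>) ?B ?Q"
    unfolding bij_betw_def using hB hQ inj_on_subset[OF inj] by blast
  have "finite ?Q"
    by (rule finite_subset[OF _ Steinberg_local_expansion(1)[OF f x, of V]]) (use V in auto)
  then have "finite ?B" using bij bij_betw_finite by blast
  then obtain n g where g: "bij_betw g {1..n::nat} ?B"
    using ex_bij_betw_nat_finite_1 by blast
  have gi: "g i \<in> ?B" if "i \<in> {1..n}" for i using g that bij_betwE by blast
  have "(\<Sum>\<gamma> \<in> {\<gamma> \<in> left_coset G k X. f (h \<cdot> \<gamma>) \<noteq> 0}. f (h \<cdot> \<gamma>)) = 0"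
    if k: "k \<in> isotropy G x" and X: "X \<in> limit_groups G x" for k X
  proof -
    note Xi = limit_group_subset[OF X]
    have sub: "left_coset G k X \<subseteq> isotropy G x"
      using left_coset_iff[OF Xi, of k] k by (auto simp: isotropy_def)
    have "left_coset G (h \<cdot> k) X = (\<lambda>\<gamma>. h \<cdot> \<gamma>) ` left_coset G k X"
      unfolding left_coset_def image_image
    proof (rule image_cong)
      fix z assume "z \<in> X"
      then have "rng G z = x" using Xi by (auto simp: isotropy_def)
      then show "(h \<cdot> k) \<cdot> z = h \<cdot> (k \<cdot> z)" using h k by (intro comp_assoc) (auto simp: isotropy_def)
    qed simp
    then have "{p. p \<in> left_coset G (h \<cdot> k) X \<and> f p \<noteq> 0} =
        (\<lambda>\<gamma>. h \<cdot> \<gamma>) ` {\<gamma> \<in> left_coset G k X. f (h \<cdot> \<gamma>) \<noteq> 0}" by auto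
    moreover have "inj_on (\<lambda>\<gamma>. h \<cdot> \<gamma>) {\<gamma> \<in> left_coset G k X. f (h \<cdot> \<gamma>) \<noteq> 0}"
      using sub by (intro inj_on_subset[OF inj]) auto
    ultimately have "(\<Sum>\<gamma> \<in> {\<gamma> \<in> left_coset G k X. f (h \<cdot> \<gamma>) \<noteq> 0}. f (h \<cdot> \<gamma>)) =
        (\<Sum>p | p \<in> left_coset G (h \<cdot> k) X \<and> f p \<noteq> 0. f p)"
      by (simp add: sum.reindex)
    also have "\<dots> = 0"
      using h k by (intro coset_sum_zero[OF f f0 X x]) (auto simp: isotropy_def src_comp)
    finally show ?thesis .
  qed
  then have "singular_datum G x (\<lambda>\<gamma>. f (h \<cdot> \<gamma>)) n g h (\<lambda>i. V (h \<cdot> g i))"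
    using x h V g by (auto simp: singular_datum_def source_fibre_def bij_betw_def)
  moreover have "singular_function G (\<lambda>\<gamma>. f (h \<cdot> \<gamma>)) n g (\<lambda>i. V (h \<cdot> g i)) W =
      cutoff G (\<lambda>\<gamma>. \<Sum>p\<in>?Q. f p * indicator (V p) \<gamma>) W" for W
  proof
    fix \<gamma>
    have "(\<Sum>p\<in>?Q. f p * indicator (V p) \<gamma>) = (\<Sum>i=1..n. f (h \<cdot> g i) * indicator (V (h \<cdot> g i)) \<gamma>)"
      using sum.reindex_bij_betw[OF bij_betw_trans[OF g bij], of "\<lambda>p. f p * indicator (V p) \<gamma>"]
      by simp
    then show "singular_function G (\<lambda>\<gamma>. f (h \<cdot> \<gamma>)) n g (\<lambda>i. V (h \<cdot> g i)) W \<gamma> =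
        cutoff G (\<lambda>\<gamma>. \<Sum>p\<in>?Q. f p * indicator (V p) \<gamma>) W \<gamma>"
      by (auto simp: singular_function_def cutoff_def restricted_bisection_def indicator_def
          sum_distrib_right intro!: sum.cong)
  qed
  ultimately show ?thesis by blast
qed

text \<open>The conclusion covers every compact open W' inside W, even those without x. This
  heredity is what later permits cutting up a compact set.\<close>

lemma local_cutoff_span:
  assumes f: "f \<in> Steinberg_algebra G" and f0: "\<And>g. src G g \<in> Hausdorff_units G \<Longrightarrow> f g = 0"
    and x: "x \<in> units G"
  obtains W where "open W" "compact W" "x \<in> W" "W \<subseteq> units G"
    "\<And>W'. open W' \<Longrightarrow> compact W' \<Longrightarrow> W' \<subseteq> W \<Longrightarrow> cutoff G f W' \<in> cfun.span (singular_functions G)"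
proof -
  have "\<exists>U. open_bisection G U \<and> p \<in> U" for p
    using compact_open_bisection_nbhd[OF open_UNIV UNIV_I] by metis
  then obtain V where V: "\<And>p. open_bisection G (V p)" "\<And>p. p \<in> V p" by metis
  define P where "P = {p. src G p = x \<and> f p \<noteq> 0}"
  have fin: "finite P" and ex: "\<forall>\<^sub>F y in nhds x. \<forall>\<gamma>. src G \<gamma> = y \<longrightarrow>
      f \<gamma> = (\<Sum>p\<in>P. f p * indicator (V p) \<gamma>)"
    unfolding P_def using Steinberg_local_expansion[OF f x, of V] V by simp_all
  obtain S where S: "open S" "x \<in> S"
    "\<And>\<gamma>. src G \<gamma> \<in> S \<Longrightarrow> f \<gamma> = (\<Sum>p\<in>P. f p * indicator (V p) \<gamma>)"
    using ex unfolding eventually_nhds by blast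
  \<comment> \<open>The share of the expansion from points of range r. Each coset lies within one
    range, so each share alone comes from a singular datum.\<close>
  define part where "part = (\<lambda>r \<gamma>. \<Sum>p | p \<in> P \<and> rng G p = r. f p * indicator (V p) \<gamma>)"
  have "\<exists>W. open W \<and> x \<in> W \<and> (\<forall>W'. open W' \<longrightarrow> compact W' \<longrightarrow> x \<in> W' \<longrightarrow> W' \<subseteq> W \<longrightarrow>
      cutoff G (part r) W' \<in> singular_functions G)" if r: "r \<in> rng G ` P" for r
  proof -
    obtain h where h: "src G h = x" "rng G h = r" using r by (auto simp: P_def)
    obtain n g where d: "singular_datum G x (\<lambda>\<gamma>. f (h \<cdot> \<gamma>)) n g h (\<lambda>i. V (h \<cdot> g i))"
      and sf: "\<And>W. singular_function G (\<lambda>\<gamma>. f (h \<cdot> \<gamma>)) n g (\<lambda>i. V (h \<cdot> g i)) W = cutoff G (part r) W"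
      using fibre_singular_datum[OF f f0 x h(1) V] unfolding part_def P_def h(2) mem_Collect_eq conj_assoc by blast
    obtain W where W: "compact W" "admissible G x n g h (\<lambda>i. V (h \<cdot> g i)) W"
      using admissible_exists[OF d] by blast
    have "cutoff G (part r) W' \<in> singular_functions G" if "open W'" "compact W'" "x \<in> W'" "W' \<subseteq> W" for W'
    proof -
      have "admissible G x n g h (\<lambda>i. V (h \<cdot> g i)) W'"
        by (rule admissible_subset[OF W(2) that(1,3,4)])
      then show ?thesis
        unfolding singular_functions_def sf[symmetric] mem_Collect_eq using d that(2)
        by (intro exI conjI) (rule refl)
    qed
    moreover have "open W" "x \<in> W" using W(2) unfolding admissible_iff by simp_all
    ultimately show ?thesis by blast
  qed
  then have "\<forall>r\<in>rng G ` P. \<exists>W. open W \<and> x \<in> W \<and> (\<forall>W'. open W' \<longrightarrow> compact W' \<longrightarrow> x \<in> W' \<longrightarrow> W' \<subseteq> W \<longrightarrow>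
      cutoff G (part r) W' \<in> singular_functions G)" by (rule ballI)
  then obtain T where T: "\<forall>r\<in>rng G ` P. open (T r) \<and> x \<in> T r \<and> (\<forall>W'. open W' \<longrightarrow> compact W' \<longrightarrow> x \<in> W' \<longrightarrow>
      W' \<subseteq> T r \<longrightarrow> cutoff G (part r) W' \<in> singular_functions G)"
    by (rule bchoice[THEN exE])
  have "open (S \<inter> (\<Inter>r\<in>rng G ` P. T r))" "x \<in> S \<inter> (\<Inter>r\<in>rng G ` P. T r)"
    using S T fin by (auto intro!: open_Int open_INT)
  then obtain W where W: "open W" "compact W" "x \<in> W" "W \<subseteq> S \<inter> (\<Inter>r\<in>rng G ` P. T r)" "W \<subseteq> units G"
    using compact_open_unit_nbhd x by metis
  have at_x: "cutoff G f W' \<in> cfun.span (singular_functions G)"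
    if W': "open W'" "compact W'" "x \<in> W'" "W' \<subseteq> W" for W'
  proof -
    have "cutoff G f W' = (\<lambda>\<gamma>. \<Sum>r\<in>rng G ` P. 1 * cutoff G (part r) W' \<gamma>)"
    proof
      fix \<gamma>
      show "cutoff G f W' \<gamma> = (\<Sum>r\<in>rng G ` P. 1 * cutoff G (part r) W' \<gamma>)"
      proof (cases "src G \<gamma> \<in> W'")
        case True
        then have "f \<gamma> = (\<Sum>p\<in>P. f p * indicator (V p) \<gamma>)" using S(3) W' W(4) by blast
        also have "\<dots> = (\<Sum>r\<in>rng G ` P. part r \<gamma>)"
          unfolding part_def using fin by (intro sum.group[symmetric]) auto
        finally show ?thesis using True by (simp add: cutoff_def)
      qed (simp add: cutoff_def)
    qed
    also have "\<dots> \<in> cfun.span (singular_functions G)"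
    proof (rule cfun_span_lincomb)
      fix r assume r: "r \<in> rng G ` P"
      then have "W' \<subseteq> T r" using W' W(4) by blast
      then show "cutoff G (part r) W' \<in> cfun.span (singular_functions G)"
        using bspec[OF T r] W' by (blast intro: cfun.span_base)
    qed (use fin in simp)
    finally show ?thesis .
  qed
  show thesis
  proof (rule that[OF W(1,2,3,5)])
    fix W' assume W': "open W'" "compact W'" "W' \<subseteq> W"
    show "cutoff G f W' \<in> cfun.span (singular_functions G)"
    proof (cases "x \<in> W'")
      \<comment> \<open>\<open>W'\<close> misses the base point \<open>x\<close>, but both \<open>W\<close> and \<open>W - W'\<close> contain it.\<close>
      case False
      have eq: "W - W' = W \<inter> (units G - W')" using W(5) by blast
      have "open (units G - W')" using compact_units_complement_open W' W(5) by blast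
      then have "open (W - W')" unfolding eq using W(1) by (rule open_Int[rotated])
      then have "cutoff G f W - cutoff G f (W - W') \<in> cfun.span (singular_functions G)"
        using W W' False by (intro cfun.span_diff at_x compact_diff) auto
      moreover have "cutoff G f W - cutoff G f (W - W') = cutoff G f W'"
        using W'(3) by (auto simp: fun_eq_iff cutoff_def indicator_def)
      ultimately show ?thesis by simp
    qed (use at_x W' in blast)
  qed
qed

lemma Steinberg_compact_source_support:
  assumes "f \<in> Steinberg_algebra G"
  shows "\<exists>K. open K \<and> compact K \<and> K \<subseteq> units G \<and> (\<forall>g. src G g \<notin> K \<longrightarrow> f g = 0)"
  using assms
proof (induction rule: Steinberg_induct)
  case zero
  show ?case by (intro exI[of _ "{}"]) auto
next
  case (add f f')
  then obtain K K' where "open K" "compact K" "K \<subseteq> units G" "\<forall>g. src G g \<notin> K \<longrightarrow> f g = 0"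
    "open K'" "compact K'" "K' \<subseteq> units G" "\<forall>g. src G g \<notin> K' \<longrightarrow> f' g = 0" by blast
  then show ?case by (intro exI[of _ "K \<union> K'"]) auto
next
  case (scale c f)
  then obtain K where "open K" "compact K" "K \<subseteq> units G" "\<forall>g. src G g \<notin> K \<longrightarrow> f g = 0" by blast
  then show ?case by (intro exI[of _ K]) auto
next
  case (indicator U)
  have "compact (src G ` U)"
    using indicator continuous_src by (intro compact_continuous_image) (auto intro: continuous_on_subset)
  then show ?case
    using indicator open_src_image open_bisectionD(1)
    by (intro exI[of _ "src G ` U"]) (auto simp: indicator_def)
qed

text \<open>Finitely many good neighbourhoods cover the compact source support. They overlap, so the
  cutoffs are not simply added: a set inside a union of A and B is split into its part in A and the
  rest, again compact and open.\<close>

lemma vanishing_in_span: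
  assumes f: "f \<in> Steinberg_algebra G" and f0: "\<And>g. src G g \<in> Hausdorff_units G \<Longrightarrow> f g = 0"
  shows "f \<in> cfun.span (singular_functions G)"
proof -
  define good where "good = (\<lambda>W. open W \<and> compact W \<and> W \<subseteq> units G \<and> (\<forall>W'. open W' \<longrightarrow> compact W' \<longrightarrow>
    W' \<subseteq> W \<longrightarrow> cutoff G f W' \<in> cfun.span (singular_functions G)))"
  have Un: "good (A \<union> B)" if A: "good A" and B: "good B" for A B
  proof -
    have "cutoff G f W' \<in> cfun.span (singular_functions G)"
      if W': "open W'" "compact W'" "W' \<subseteq> A \<union> B" for W'
    proof -
      have AB: "open A" "compact A" "A \<subseteq> units G" "W' \<subseteq> units G" using A B W' by (auto simp: good_def)
      have "open (units G - A)" using compact_units_complement_open AB by blast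
      moreover have "W' - A = W' \<inter> (units G - A)" using AB by blast
      ultimately have "open (W' - A)" using W'(1) by (simp add: open_Int)
      moreover have "compact (W' - A)" using W' AB by (intro compact_diff)
      moreover have "W' - A \<subseteq> B" using W' by blast
      ultimately have "cutoff G f (W' - A) \<in> cfun.span (singular_functions G)"
        using B unfolding good_def by blast
      moreover have "cutoff G f (W' \<inter> A) \<in> cfun.span (singular_functions G)"
        using A W' AB compact_units_Int[of W' A] unfolding good_def by (metis Int_lower2 open_Int)
      ultimately have "cutoff G f (W' \<inter> A) + cutoff G f (W' - A) \<in> cfun.span (singular_functions G)"
        by (rule cfun.span_add[rotated])
      moreover have "cutoff G f (W' \<inter> A) + cutoff G f (W' - A) = cutoff G f W'"
        by (auto simp: fun_eq_iff cutoff_def indicator_def)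
      ultimately show ?thesis by simp
    qed
    then show ?thesis using A B unfolding good_def by (auto intro: compact_Un)
  qed
  have "cutoff G f {} = 0" by (simp add: cutoff_def fun_eq_iff)
  then have good_empty: "good {}" by (auto simp: good_def cfun.span_zero)
  obtain K where K: "open K" "compact K" "K \<subseteq> units G" "\<And>g. src G g \<notin> K \<Longrightarrow> f g = 0"
    using Steinberg_compact_source_support[OF f] by blast
  have "\<exists>W. good W \<and> x \<in> W" if "x \<in> K" for x
  proof -
    have "x \<in> units G" using that K(3) by blast
    then show ?thesis
      using local_cutoff_span[OF f f0, of x] unfolding good_def by metis
  qed
  then have cover: "K \<subseteq> \<Union>{W. good W}" by blast
  have "\<And>W. W \<in> {W. good W} \<Longrightarrow> open W" by (simp add: good_def)
  then obtain \<D> where \<D>: "\<D> \<subseteq> {W. good W}" "finite \<D>" "K \<subseteq> \<Union>\<D>"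
    using compactE[OF K(2) cover] by metis
  have "good (\<Union>\<D>)"
    using \<D>(2,1) by (induction rule: finite_induct) (auto simp: good_empty intro: Un)
  then have "cutoff G f K \<in> cfun.span (singular_functions G)"
    using K \<D>(3) by (simp add: good_def)
  moreover have "cutoff G f K = f"
    using K(4) by (auto simp: fun_eq_iff cutoff_def indicator_def)
  ultimately show ?thesis by simp
qed

end

theorem theorem6:
  fixes G :: "'g::topological_space groupoid_struct"
  assumes "ample_groupoid G"
    and "\<exists>\<U>. countable \<U> \<and> (\<forall>U\<in>\<U>. open_bisection G U) \<and> \<Union>\<U> = UNIV"
  shows "(\<forall>x b n g h V. singular_datum G x b n g h V \<longrightarrow>
            (\<exists>W. compact W \<and> admissible G x n g h V W) \<and>
            (\<forall>W. compact W \<and> admissible G x n g h V W \<longrightarrow>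
               singular_function G b n g V W \<in> algebraic_singular_ideal G)) \<and>
         algebraic_singular_ideal G =
           cfun.span {singular_function G b n g V W | x b n g h V W.
             singular_datum G x b n g h V \<and> compact W \<and> admissible G x n g h V W}"
proof -
  interpret ample_groupoid G by (rule assms(1))
  have dense: "S \<inter> Hausdorff_units G \<noteq> {}" if "open S" "S \<subseteq> units G" "S \<noteq> {}" for S
  proof -
    obtain \<U> where \<U>: "countable \<U>" "\<forall>U\<in>\<U>. open_bisection G U" "\<Union>\<U> = UNIV"
      using assms(2) by (elim exE conjE)
    show ?thesis
      by (rule Hausdorff_units_dense[OF \<U>(1) bspec[OF \<U>(2)] \<U>(3) that])
  qed
  have J_iff: "f \<in> algebraic_singular_ideal G \<longleftrightarrow>
      f \<in> Steinberg_algebra G \<and> (\<forall>g. src G g \<in> Hausdorff_units G \<longrightarrow> f g = 0)" for f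
    using algebraic_singular_ideal_iff Steinberg_empty_interior_iff[OF _ dense] by blast
  have J: "singular_function G b n g V W \<in> algebraic_singular_ideal G"
    if "singular_datum G x b n g h V" "compact W" "admissible G x n g h V W" for x b n g h V W
    using singular_function_Steinberg[OF that] singular_function_vanishes[OF that(1,3)]
    unfolding J_iff by blast
  \<comment> \<open>Vanishing over the Hausdorff units is a linear condition, unlike having a
    nonvanishing set with empty interior on its face.\<close>
  have "cfun.subspace (algebraic_singular_ideal G)"
    by (rule cfun_subspaceI) (auto simp: J_iff Steinberg_zero Steinberg_add Steinberg_scale)
  then have "cfun.span (singular_functions G) \<subseteq> algebraic_singular_ideal G"
    using J by (intro cfun.span_minimal) (auto simp: singular_functions_def)
  moreover have "algebraic_singular_ideal G \<subseteq> cfun.span (singular_functions G)"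
    using vanishing_in_span by (auto simp: J_iff)
  ultimately have "algebraic_singular_ideal G = cfun.span (singular_functions G)" by blast
  then show ?thesis
    unfolding singular_functions_def[symmetric]
  proof (intro conjI allI impI)
    fix x b n g h V assume d: "singular_datum G x b n g h V"
    show "\<exists>W. compact W \<and> admissible G x n g h V W" by (rule admissible_exists[OF d])
    fix W assume "compact W \<and> admissible G x n g h V W"
    then show "singular_function G b n g V W \<in> algebraic_singular_ideal G" using J[OF d] by blast
  qed
qed

end
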